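(* Let $L$ be the length of the longest run of consecutive equal parts in a uniformly random integer composition of size $n$. Then, as $n\to\infty$, the expected value of $L$ satisfies $$\mathbb{E}_n(L)=\lg n+\frac{\gamma}{\log 2}-\frac52+P(\lg n)+O\left(\frac{\log^2 n}{\sqrt n}\right),$$ where $P$ is a continuous periodic function whose Fourier expansion is given by $$P(w)=-\frac{1}{\log 2}\sum_{k\in\mathbb{Z}\setminus\{0\}}\Gamma\left(\frac{2ik\pi}{\log 2}\right)e^{-2ik\pi w}.$$
   Context: A composition of size $n$ is a finite sequence $(x_1,\dots,x_m)$ of positive integers (the parts) with $x_1+\cdots+x_m=n$. $\mathbb{E}_n$ denotes expectation under the model in which all compositions of size $n$ are equally likely. $L$ is the random variable giving the maximal length of a block of consecutive equal parts. Notation: $\lg n=\log_2 n$, $\log$ is the natural logarithm, $\gamma$ is Euler's constant, $\Gamma$ is the Euler Gamma function, and $i$ is the imaginary unit. *)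

theory Defs
  imports
    "HOL-Probability.Probability"
    "HOL-Library.Sublist"
    "HOL-Library.Landau_Symbols"
begin

definition compositions :: "nat \<Rightarrow> nat list set" where
  "compositions n = {xs. (\<forall>x\<in>set xs. 0 < x) \<and> sum_list xs = n}"

(* The set always contains 0 and, for nonempty xs, also 1; allowing k = 0 only serves to
   give the empty composition the value 0. *)
definition longest_run :: "'a list \<Rightarrow> nat" where
  "longest_run xs = Max {k. \<exists>a. sublist (replicate k a) xs}"

definition composition_expectation :: "nat \<Rightarrow> (nat list \<Rightarrow> real) \<Rightarrow> real" where
  "composition_expectation n X = measure_pmf.expectation (pmf_of_set (compositions n)) X"

(* pmf_of_set and Max are meaningful only for finite nonempty sets. *)

lemma finite_compositions: "finite (compositions n)"
proof (rule finite_subset)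
  have len: "length xs \<le> sum_list xs" if "\<forall>x\<in>set xs. 0 < x" for xs :: "nat list"
    using that by (induction xs) auto
  show "compositions n \<subseteq> {xs. set xs \<subseteq> {..n} \<and> length xs \<le> n}"
    using len by (auto simp: compositions_def intro: member_le_sum_list)
  show "finite {xs. set xs \<subseteq> {..n} \<and> length xs \<le> n}"
    by (rule finite_lists_length_le) simp
qed

lemma compositions_nonempty: "compositions n \<noteq> {}"
proof -
  have "replicate n 1 \<in> compositions n"
    by (auto simp: compositions_def sum_list_replicate)
  then show ?thesis by blast
qed

lemma finite_run_lengths: "finite {k. \<exists>a. sublist (replicate k a) xs}"
proof (rule finite_subset)
  show "{k. \<exists>a. sublist (replicate k a) xs} \<subseteq> {..length xs}"
    by (auto dest: sublist_length_le)
qed simp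

lemma run_lengths_nonempty: "{k. \<exists>a. sublist (replicate k a) xs} \<noteq> {}"
proof -
  have "0 \<in> {k. \<exists>a. sublist (replicate k a) xs}" by simp
  then show ?thesis by blast
qed

end

theory Submission
  imports Defs "HOL-Real_Asymp.Real_Asymp"
begin

text \<open>
  Two independent facts give the result.

  \<^item> The longest run is, up to a negligible probability, a run of ones: a run of more than \<open>k\<close>
    parts equal to some \<open>a \<ge> 2\<close>, without such a run of ones, has probability at most
    \<open>(n + 1) / 4^k\<close>, which is small for \<open>k\<close> near \<open>lg n\<close>, the typical length of the longest run of
    ones (\<open>ones_bounded_prob_minus_short_runs_prob\<close>). The probability \<open>q\<^sub>n\<close> that no
    run of ones is longer than \<open>k\<close> satisfies the linear recurrence
    \<open>q\<^sub>m = q\<^sub>m\<^sub>-\<^sub>1 - \<delta> q\<^sub>m\<^sub>-\<^sub>k\<^sub>-\<^sub>3\<close> with \<open>\<delta> = 1 / 2^(k + 3)\<close> (\<open>card_ones_bounded_rec\<close>). As \<open>q\<close> hardly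
    changes over \<open>k + 3\<close> steps, each step multiplies it by nearly \<open>1 - \<delta>\<close>, so that
    \<open>q\<^sub>n \<approx> exp (- n / 2^(k + 3))\<close> (locale \<open>delayed_recurrence\<close>). Summing the tail probabilities over
    \<open>k\<close> shows that the expectation is \<open>\<Sum>k. 1 - exp (- x / 2^k)\<close> at \<open>x = n / 8\<close>, up to an error
    that the error term absorbs (\<open>expectation_longest_run_doubling_sum\<close>).

  \<^item> The function \<open>T x = (\<Sum>k. 1 - exp (- x / 2^k))\<close> almost satisfies \<open>T (2 * x) = T x + 1\<close>. Adding
    the terms for negative \<open>k\<close>, with the constant \<open>1\<close> removed from each, makes this exact, so \<open>T (2^w)\<close>
    differs from \<open>w\<close> by a continuous function of period \<open>1\<close>, the \<open>fluctuation\<close>, and by an error of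
    at most \<open>1 / 2^w\<close>. Its Fourier coefficients are found by unfolding: under \<open>u = 2^w\<close> the unit
    intervals of \<open>w\<close> become the dyadic pieces of the half-line, and the coefficient becomes the
    Mellin transform of \<open>exp (- u) - [u \<le> 1]\<close> at \<open>s = 2 \<pi> i k / ln 2\<close>. To the right of the
    imaginary axis this transform is \<open>Gamma s - 1 / s\<close>, and by continuity also on it, with the value
    \<open>-\<gamma>\<close> at \<open>s = 0\<close> because \<open>Gamma' 1 = -\<gamma>\<close>. The Fourier series represents the fluctuation because
    \<open>Gamma\<close> decays quadratically along the points \<open>2 \<pi> i k / ln 2\<close> and because a continuous periodic
    function is determined by its Fourier coefficients (\<open>fourier_inversion\<close>).

  The constant consists of the zeroth coefficient \<open>\<gamma> / ln 2 + 1/2\<close> and of the \<open>-3\<close> in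
  \<open>lg (n / 8) = lg n - 3\<close>.
\<close>

section \<open>Counting compositions\<close>

lemma Cons_in_compositions:
  "y # ys \<in> compositions n \<longleftrightarrow> 0 < y \<and> (\<exists>m. n = y + m \<and> ys \<in> compositions m)"
  by (auto simp: compositions_def)

lemma compositions_0: "compositions 0 = {[]}"
proof (rule set_eqI)
  fix xs show "xs \<in> compositions 0 \<longleftrightarrow> xs \<in> {[]}"
    by (cases xs) (auto simp: compositions_def)
qed

text \<open>Prepending a part 1 and enlarging the first part by 1 together produce every composition of
  \<open>n + 1\<close> from those of \<open>n \<ge> 1\<close> exactly once.\<close>

definition grow_head :: "nat list \<Rightarrow> nat list" where
  "grow_head xs = Suc (hd xs) # tl xs"

lemma inj_on_grow_head: "inj_on grow_head (compositions (Suc n))"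
proof (rule inj_onI)
  fix xs ys assume "xs \<in> compositions (Suc n)" "ys \<in> compositions (Suc n)" "grow_head xs = grow_head ys"
  then show "xs = ys" by (cases xs; cases ys) (auto simp: compositions_def grow_head_def)
qed

lemma card_compositions_Suc: "card (compositions (Suc n)) = 2 ^ n"
proof (induction n)
  case 0
  have "compositions (Suc 0) = {[1]}"
  proof (rule set_eqI)
    fix xs show "xs \<in> compositions (Suc 0) \<longleftrightarrow> xs \<in> {[1]}"
      proof (cases xs)
      case Nil
      then show ?thesis by (simp add: compositions_def)
    next
      case (Cons y ys)
      show ?thesis
        unfolding Cons Cons_in_compositions
        by (cases y) (auto simp: compositions_0)
    qed
  qed
  then show ?case by simp
next
  case (Suc n)
  have "compositions (Suc (Suc n)) = (#) 1 ` compositions (Suc n) \<union> grow_head ` compositions (Suc n)"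
    (is "?A = ?B \<union> ?C")
  proof (intro equalityI subsetI)
    fix xs assume "xs \<in> ?A"
    then obtain y ys where xs: "xs = y # ys" "0 < y" "y # ys \<in> ?A"
      by (cases xs) (auto simp: compositions_def)
    show "xs \<in> ?B \<union> ?C"
    proof (cases "y = 1")
      case True
      with xs show ?thesis by (auto simp: Cons_in_compositions)
    next
      case False
      with xs obtain z where z: "y = Suc z" "0 < z" by (cases y) auto
      then have "z # ys \<in> compositions (Suc n)" "xs = grow_head (z # ys)"
        using xs by (auto simp: compositions_def grow_head_def)
      then show ?thesis by blast
    qed
  next
    fix xs assume "xs \<in> ?B \<union> ?C"
    then obtain ys where ys: "ys \<in> compositions (Suc n)" and xs: "xs = 1 # ys \<or> xs = grow_head ys"
      by auto
    from ys obtain z zs where "ys = z # zs" by (cases ys) (auto simp: compositions_def)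
    with ys xs show "xs \<in> ?A" by (auto simp: compositions_def grow_head_def)
  qed
  moreover have "?B \<inter> ?C = {}"
  proof -
    have "hd xs \<noteq> 1" if "xs \<in> ?C" for xs
    proof -
      from that obtain ys where "ys \<in> compositions (Suc n)" "xs = grow_head ys" by blast
      then show ?thesis by (cases ys) (auto simp: compositions_def grow_head_def)
    qed
    moreover have "hd xs = 1" if "xs \<in> ?B" for xs
      using that by auto
    ultimately show ?thesis by blast
  qed
  moreover have "card ?B = 2 ^ n" "card ?C = 2 ^ n"
    using Suc by (simp_all add: card_image inj_on_grow_head)
  ultimately show ?case by (simp add: card_Un_disjoint finite_compositions)
qed

lemma card_compositions_le: "card (compositions n) \<le> 2 ^ n"
  by (cases n) (simp_all add: compositions_0 card_compositions_Suc)

section \<open>Compositions whose runs of ones are bounded\<close>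

definition ones_bounded :: "nat \<Rightarrow> nat \<Rightarrow> nat list set" where
  "ones_bounded k n = {xs \<in> compositions n. \<not> sublist (replicate (Suc k) 1) xs}"

text \<open>Keeping track of the number of leading ones makes it possible to strip parts from the front:
  removing a leading 1 lowers the bound \<open>j\<close> by one, and behind a first part other than 1 any
  composition counted by \<open>ones_bounded\<close> may follow.\<close>

definition few_leading_ones :: "nat \<Rightarrow> nat \<Rightarrow> nat \<Rightarrow> nat list set" where
  "few_leading_ones j k n = {xs \<in> ones_bounded k n. \<not> prefix (replicate (Suc j) 1) xs}"

lemma finite_ones_bounded [simp]: "finite (ones_bounded k n)"
  by (simp add: ones_bounded_def finite_compositions)

lemma finite_few_leading_ones [simp]: "finite (few_leading_ones j k n)"
  by (simp add: few_leading_ones_def)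

lemma few_leading_ones_self: "few_leading_ones k k n = ones_bounded k n"
  by (auto simp: few_leading_ones_def ones_bounded_def)

lemma prefix_replicate_le:
  assumes "i \<le> j" "prefix (replicate j x) xs"
  shows "prefix (replicate i x) xs"
proof -
  have "prefix (replicate i x) (replicate j x)"
    using assms(1) by (metis le_add_diff_inverse prefixI replicate_add)
  then show ?thesis using assms(2) prefix_order.trans by blast
qed

lemma Cons_1_in_few_leading_ones:
  assumes "j < k"
  shows "1 # xs \<in> few_leading_ones (Suc j) k (Suc n) \<longleftrightarrow> xs \<in> few_leading_ones j k n"
  using prefix_replicate_le[of "Suc j" k 1 xs] assms
  by (auto simp: few_leading_ones_def ones_bounded_def Cons_in_compositions sublist_Cons_right)

lemma Cons_in_few_leading_ones:
  assumes "y \<noteq> 1"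
  shows "y # xs \<in> few_leading_ones j k n \<longleftrightarrow> 0 < y \<and> (\<exists>m. n = y + m \<and> xs \<in> ones_bounded k m)"
  using assms by (auto simp: few_leading_ones_def ones_bounded_def Cons_in_compositions sublist_Cons_right)

lemma few_leading_ones_0_0: "few_leading_ones 0 k 0 = {[]}"
  by (auto simp: few_leading_ones_def ones_bounded_def compositions_0)

lemma few_leading_ones_0_E:
  assumes "xs \<in> few_leading_ones 0 k (Suc n)"
  obtains y ys m where "xs = y # ys" "2 \<le> y" "Suc n = y + m" "ys \<in> ones_bounded k m"
proof (cases xs)
  case Nil
  with assms show ?thesis by (auto simp: few_leading_ones_def ones_bounded_def compositions_def)
next
  case (Cons y ys)
  have "y \<noteq> 1"
    using assms Cons by (auto simp: few_leading_ones_def)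
  with assms Cons that show ?thesis by (fastforce simp: Cons_in_few_leading_ones)
qed

lemma few_leading_ones_0_1: "few_leading_ones 0 k (Suc 0) = {}"
  by (auto elim!: few_leading_ones_0_E)

lemma card_few_leading_ones_Suc:
  assumes "j < k"
  shows "card (few_leading_ones (Suc j) k (Suc n)) =
           card (few_leading_ones 0 k (Suc n)) + card (few_leading_ones j k n)"
proof -
  have "few_leading_ones (Suc j) k (Suc n) =
          few_leading_ones 0 k (Suc n) \<union> (#) 1 ` few_leading_ones j k n" (is "?A = ?B \<union> ?C")
  proof (rule set_eqI)
    fix xs show "xs \<in> ?A \<longleftrightarrow> xs \<in> ?B \<union> ?C"
    proof (cases xs)
      case Nil
      then show ?thesis by (auto simp: few_leading_ones_def)
    next
      case (Cons y ys)
      show ?thesis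
      proof (cases "y = 1")
        case True
        have "1 # ys \<notin> ?B" by (auto simp: few_leading_ones_def)
        with True Cons Cons_1_in_few_leading_ones[OF assms, of ys n] show ?thesis by auto
      next
        case False
        with Cons show ?thesis by (auto simp: Cons_in_few_leading_ones)
      qed
    qed
  qed
  moreover have "?B \<inter> ?C = {}" by (auto simp: few_leading_ones_def)
  ultimately show ?thesis by (simp add: card_Un_disjoint card_image)
qed

text \<open>A first part that is at least 3 can be lowered by 1; a first part 2 can be dropped.\<close>

lemma card_few_leading_ones_0_Suc:
  "card (few_leading_ones 0 k (Suc (Suc n))) =
     card (few_leading_ones 0 k (Suc n)) + card (ones_bounded k n)"
proof -
  have "few_leading_ones 0 k (Suc (Suc n)) =
          grow_head ` few_leading_ones 0 k (Suc n) \<union> (#) 2 ` ones_bounded k n" (is "?A = ?B \<union> ?C")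
  proof (intro equalityI subsetI)
    fix xs assume "xs \<in> ?A"
    then obtain y ys m where xs: "xs = y # ys" "2 \<le> y" "Suc (Suc n) = y + m" "ys \<in> ones_bounded k m"
      by (rule few_leading_ones_0_E)
    show "xs \<in> ?B \<union> ?C"
    proof (cases "y = 2")
      case True
      with xs show ?thesis by auto
    next
      case False
      then obtain z where "y = Suc z" "2 \<le> z" using xs(2) by (cases y) auto
      then have "xs = grow_head (z # ys)" "z # ys \<in> few_leading_ones 0 k (Suc n)"
        using xs by (auto simp: grow_head_def Cons_in_few_leading_ones)
      then show ?thesis by blast
    qed
  next
    fix xs assume "xs \<in> ?B \<union> ?C"
    then show "xs \<in> ?A"
      by (auto elim!: few_leading_ones_0_E simp: grow_head_def Cons_in_few_leading_ones)
  qed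
  moreover have "?B \<inter> ?C = {}"
    by (auto elim!: few_leading_ones_0_E simp: grow_head_def)
  moreover have "inj_on grow_head (few_leading_ones 0 k (Suc n))"
    by (rule inj_on_subset[OF inj_on_grow_head]) (auto simp: few_leading_ones_def ones_bounded_def)
  ultimately show ?thesis by (simp add: card_Un_disjoint card_image)
qed

lemma card_few_leading_ones_sum:
  assumes "j \<le> k" "j \<le> n"
  shows "card (few_leading_ones j k n) = (\<Sum>i\<le>j. card (few_leading_ones 0 k (n - i)))"
  using assms
proof (induction j arbitrary: n)
  case (Suc j)
  then obtain m where "n = Suc m" by (cases n) auto
  with Suc show ?case
    by (simp add: card_few_leading_ones_Suc sum.atMost_Suc_shift del: sum.atMost_Suc)
qed simp

text \<open>Only the windows of the sums in \<open>card_few_leading_ones_sum\<close> at \<open>n\<close> and \<open>n + 1\<close> differ, by one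
  term at either end.\<close>

lemma card_ones_bounded_Suc:
  assumes "k \<le> n"
  shows "card (ones_bounded k (Suc n)) + card (few_leading_ones 0 k (n - k)) =
           card (ones_bounded k n) + card (few_leading_ones 0 k (Suc n))"
proof -
  have "(\<Sum>i\<le>k. f (Suc n - i)) + f (n - k) = f (Suc n) + (\<Sum>i\<le>k. f (n - i))"
    for f :: "nat \<Rightarrow> nat"
    using sum.atMost_Suc_shift[of "\<lambda>i. f (Suc n - i)" k] by simp
  from this[of "\<lambda>i. card (few_leading_ones 0 k i)"] show ?thesis
    using assms card_few_leading_ones_sum[of k k n] card_few_leading_ones_sum[of k k "Suc n"]
    by (simp add: few_leading_ones_self)
qed

text \<open>The second difference of the count: the boundary terms of \<open>card_ones_bounded_Suc\<close> at two
  consecutive sizes are counts of compositions without a leading 1, whose increments are again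
  values of the count by \<open>card_few_leading_ones_0_Suc\<close>.\<close>

lemma card_ones_bounded_rec:
  "card (ones_bounded k (m + k + 3)) + card (ones_bounded k m) = 2 * card (ones_bounded k (m + k + 2))"
proof -
  have [simp]: "m + k + 3 = Suc (Suc (Suc (m + k)))" "m + k + 2 = Suc (Suc (m + k))" by simp_all
  show ?thesis
  using card_ones_bounded_Suc[of k "m + k + 2"] card_ones_bounded_Suc[of k "m + k + 1"]
    card_few_leading_ones_0_Suc[of k m] card_few_leading_ones_0_Suc[of k "m + k + 1"]
    by (simp add: Suc_diff_le)
qed

lemma card_ones_bounded_small:
  assumes "0 < n" "n \<le> k"
  shows "card (ones_bounded k n) = 2 ^ (n - 1)"
proof -
  have "sum_list xs \<ge> Suc k" if "sublist (replicate (Suc k) (1::nat)) xs" for xs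
    using that by (auto simp: sublist_def sum_list_replicate)
  then have "ones_bounded k n = compositions n"
    using assms by (fastforce simp: ones_bounded_def compositions_def)
  then show ?thesis using assms card_compositions_Suc[of "n - 1"] by simp
qed

lemma card_ones_bounded_0: "card (ones_bounded k 0) = 1"
proof -
  have "ones_bounded k 0 = {[]}" by (auto simp: ones_bounded_def compositions_0)
  then show ?thesis by simp
qed

text \<open>The only composition of \<open>k + 1\<close> with \<open>k + 1\<close> consecutive ones is the one without other parts.\<close>

lemma card_ones_bounded_Suc_k: "card (ones_bounded k (Suc k)) = 2 ^ k - 1"
proof -
  have "xs = replicate (Suc k) 1" 
    if "xs \<in> compositions (Suc k)" "sublist (replicate (Suc k) 1) xs" for xs
  proof -
    from that(2) obtain ps ss where xs: "xs = ps @ replicate (Suc k) 1 @ ss"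
      by (auto simp: sublist_def simp del: replicate.simps)
    have pos: "\<forall>x\<in>set ps. 0 < x" "\<forall>x\<in>set ss. 0 < x"
    proof -
      have "\<forall>x\<in>set xs. 0 < x" using that(1) by (simp add: compositions_def)
      then show "\<forall>x\<in>set ps. 0 < x" "\<forall>x\<in>set ss. 0 < x" unfolding xs set_append by blast+
    qed
    have "sum_list xs = sum_list ps + Suc k + sum_list ss"
      unfolding xs by (simp add: sum_list_replicate del: replicate.simps)
    then have "sum_list ps = 0" "sum_list ss = 0"
      using that(1) by (simp_all add: compositions_def)
    with pos have "ps = []" "ss = []"
      by (cases ps; auto) (use pos \<open>sum_list ss = 0\<close> in \<open>cases ss; auto\<close>)
    with xs show ?thesis by simp
  qed
  moreover have "replicate (Suc k) 1 \<in> compositions (Suc k)"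
    by (auto simp: compositions_def sum_list_replicate)
  ultimately have "ones_bounded k (Suc k) = compositions (Suc k) - {replicate (Suc k) 1}"
    by (auto simp: ones_bounded_def simp del: replicate.simps)
  then show ?thesis
    using \<open>replicate (Suc k) 1 \<in> compositions (Suc k)\<close>
    by (simp add: card_compositions_Suc del: replicate.simps)
qed

lemma card_ones_bounded_Suc_Suc_k:
  assumes "0 < k"
  shows "card (ones_bounded k (k + 2)) = 2 ^ Suc k - 1"
proof -
  have "card (ones_bounded k (k + 2)) = 2 * card (ones_bounded k (Suc k)) + 1"
    using card_ones_bounded_Suc[of k k] card_ones_bounded_Suc[of k "Suc k"]
      card_few_leading_ones_0_Suc[of k k]
    by (simp add: few_leading_ones_0_0 few_leading_ones_0_1)
  moreover have "(1::nat) \<le> 2 ^ k" by simp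
  ultimately show ?thesis
    using card_ones_bounded_Suc_k[of k] power_Suc[of "2::nat" k] by linarith
qed

section \<open>A linear recurrence with delay\<close>

lemma power_chain:
  fixes q :: "nat \<Rightarrow> real"
  assumes "0 \<le> c" "\<And>j. m \<le> j \<Longrightarrow> j < m + i \<Longrightarrow> c * q j \<le> q (Suc j)"
  shows "c ^ i * q m \<le> q (m + i)"
  using assms(2)
proof (induction i)
  case (Suc i)
  then have "c * (c ^ i * q m) \<le> c * q (m + i)"
    using assms(1) by (intro mult_left_mono) auto
  also have "\<dots> \<le> q (m + Suc i)" using Suc.prems[of "m + i"] by simp
  finally show ?case by (simp add: mult.assoc)
qed simp

text \<open>The recurrence for the probability that a random composition of size \<open>n\<close> has no run of more
  than \<open>k\<close> ones. Its first values are slightly irregular: \<open>q 0 = 2\<close> because the count 1 at size 0 is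
  divided by \<open>2^(n - 1) = 1/2\<close>, and \<open>q\<close> increases from \<open>k + 1\<close> to \<open>k + 2\<close>.
  The bound \<open>4 \<le> k\<close> ensures that \<open>(k + 3) * \<delta>\<close> is small.\<close>

locale delayed_recurrence =
  fixes q :: "nat \<Rightarrow> real" and k :: nat and \<delta> :: real
  defines "\<delta> \<equiv> 1 / 2 ^ (k + 3)"
  assumes k: "4 \<le> k"
    and nonneg: "\<And>n. 0 \<le> q n"
    and rec: "\<And>m. q (m + k + 3) = q (m + k + 2) - \<delta> * q m"
    and q_0: "q 0 = 2"
    and q_small: "\<And>n. 0 < n \<Longrightarrow> n \<le> k \<Longrightarrow> q n = 1"
    and q_Suc_k: "q (Suc k) = 1 - 8 * \<delta>"
    and q_Suc_Suc_k: "q (k + 2) = 1 - 4 * \<delta>"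
begin

lemma \<delta>_pos: "0 < \<delta>" by (simp add: \<delta>_def)

lemma \<delta>_small: "16 * real (k + 3) * \<delta> \<le> 1"
proof -
  have "16 * (k + 3) \<le> 2 ^ (k + 3)" using k
  proof (induction k rule: dec_induct)
    case (step n)
    then show ?case by (simp add: power_add)
  qed simp
  then have "real (16 * (k + 3)) \<le> real (2 ^ (k + 3))" by (rule of_nat_mono)
  then show ?thesis by (simp add: \<delta>_def field_simps)
qed

lemma \<delta>_le: "\<delta> \<le> 1 / 112"
proof -
  have "16 * 7 * \<delta> \<le> 16 * real (k + 3) * \<delta>"
    using k \<delta>_pos by (intro mult_right_mono) auto
  with \<delta>_small show ?thesis by simp
qed

lemma rec_Suc:
  assumes "k + 2 \<le> n"
  shows "q (Suc n) = q n - \<delta> * q (n - (k + 2))"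
proof -
  obtain m where n: "n = m + k + 2" using assms by (metis add.commute add.left_commute le_Suc_ex)
  have "Suc n = m + k + 3" "n - (k + 2) = m" by (simp_all add: n)
  then show ?thesis using rec[of m] by (simp only: n)
qed

lemma antimono_step: "k + 2 \<le> n \<Longrightarrow> q (Suc n) \<le> q n"
  using rec_Suc[of n] nonneg[of "n - (k + 2)"] \<delta>_pos by simp

lemma antimono:
  assumes "k + 2 \<le> m" "m \<le> n"
  shows "q n \<le> q m"
  using assms(2)
proof (induction n rule: dec_induct)
  case (step i)
  then show ?case using antimono_step[of i] assms(1) by simp
qed simp

lemma le_1:
  assumes "0 < n"
  shows "q n \<le> 1"
proof -
  consider "n \<le> k" | "n = Suc k" | "k + 2 \<le> n" by linarith
  then show ?thesis
  proof cases
    case 3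
    then show ?thesis using antimono[of "k + 2" n] q_Suc_Suc_k \<delta>_pos by simp
  qed (use assms q_small q_Suc_k \<delta>_pos in auto)
qed

text \<open>From \<open>k + 2\<close> on the sequence decreases, so beyond \<open>2 * k + 4\<close> the delayed value that is
  subtracted is at least the current one and each step gains a factor \<open>1 - \<delta>\<close>. Up to \<open>2 * k + 4\<close> the
  bound is at least 1, which \<open>q\<close> does not exceed.\<close>

lemma upper_bound:
  assumes "0 < n"
  shows "q n \<le> exp (- \<delta> * (real n - 2 * real k - 4))"
proof (cases "n \<le> 2 * k + 4")
  case True
  then have "0 \<le> - \<delta> * (real n - 2 * real k - 4)"
    using \<delta>_pos by (intro mult_nonpos_nonpos) auto
  then have "1 \<le> exp (- \<delta> * (real n - 2 * real k - 4))" by (subst one_le_exp_iff)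
  with le_1[OF assms] show ?thesis by linarith
next
  case False
  then have "2 * k + 4 \<le> n" by simp
  then show ?thesis
  proof (induction n rule: dec_induct)
    case base
    then show ?case using le_1[of "2 * k + 4"] by simp
  next
    case (step n)
    have "q (Suc n) = q n - \<delta> * q (n - (k + 2))"
      using rec_Suc[of n] step.hyps by simp
    also have "\<dots> \<le> q n - \<delta> * q n"
      using antimono[of "n - (k + 2)" n] step.hyps \<delta>_pos by simp
    also have "\<dots> = (1 - \<delta>) * q n" by (simp add: algebra_simps)
    also have "\<dots> \<le> exp (- \<delta>) * exp (- \<delta> * (real n - 2 * real k - 4))"
      using exp_ge_add_one_self[of "- \<delta>"] step.IH nonneg by (intro mult_mono) auto
    also have "\<dots> = exp (- \<delta> * (real (Suc n) - 2 * real k - 4))"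
      by (simp add: exp_add[symmetric] algebra_simps)
    finally show ?case .
  qed
qed

lemma Bernoulli_k: "1 - 8 * real (k + 2) * \<delta> \<le> (1 - 8 * \<delta>) ^ (k + 2)"
  using Bernoulli_inequality[of "- (8 * \<delta>)" "k + 2"] \<delta>_le by (simp add: algebra_simps)

text \<open>The sequence loses at most the fraction \<open>8 * \<delta>\<close> in one step; the constant 8 is forced by the
  drop at \<open>k + 1\<close>. Inductively, the delayed value then exceeds the current one by at most the
  factor 8, which reproduces the bound.\<close>

lemma crude_ratio:
  assumes "0 < n"
  shows "(1 - 8 * \<delta>) * q n \<le> q (Suc n)"
  using assms
proof (induction n rule: less_induct)
  case (less n)
  consider "n < k" | "n = k" | "n = k + 1" | "n = k + 2" | "k + 2 < n" by linarith
  then show ?case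
  proof cases
    case 1
    then show ?thesis using less.prems q_small[of n] q_small[of "Suc n"] \<delta>_pos by simp
  next
    case 2
    then show ?thesis using less.prems q_small[of n] q_Suc_k by simp
  next
    case 3
    have "(1 - 8 * \<delta>) * (1 - 8 * \<delta>) \<le> 1 * (1 - 8 * \<delta>)"
      using \<delta>_le \<delta>_pos by (intro mult_right_mono) auto
    then show ?thesis using 3 q_Suc_k q_Suc_Suc_k \<delta>_pos by simp
  next
    case 4
    have "32 * (\<delta> * \<delta>) \<le> 6 * \<delta>"
      using mult_right_mono[OF \<delta>_le, of \<delta>] \<delta>_pos by simp
    moreover have "q n = 1 - 4 * \<delta>" "q (Suc n) = 1 - 6 * \<delta>"
      using 4 q_Suc_Suc_k rec_Suc[of n] q_0 by simp_all
    moreover have "(1 - 8 * \<delta>) * (1 - 4 * \<delta>) = 1 - 12 * \<delta> + 32 * (\<delta> * \<delta>)"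
      by (simp add: algebra_simps)
    ultimately show ?thesis by simp
  next
    case 5
    define m where "m = n - (k + 2)"
    have m: "0 < m" "n = m + (k + 2)" using 5 by (auto simp: m_def)
    have "(1 - 8 * real (k + 2) * \<delta>) * q m \<le> (1 - 8 * \<delta>) ^ (k + 2) * q m"
      using Bernoulli_k nonneg by (rule mult_right_mono)
    also have "\<dots> \<le> q n"
      unfolding m(2) using m \<delta>_le by (intro power_chain less.IH) auto
    finally have 1: "(1 - 8 * real (k + 2) * \<delta>) * q m \<le> q n" .
    have "1 / 8 \<le> 1 - 8 * real (k + 2) * \<delta>"
      using \<delta>_small \<delta>_pos by (simp add: algebra_simps)
    then have "1 / 8 * q m \<le> q n" using mult_right_mono[OF _ nonneg] 1 order_trans by blast
    then have "\<delta> * q m \<le> \<delta> * (8 * q n)" using \<delta>_pos by (intro mult_left_mono) auto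
    then show ?thesis using rec_Suc[of n] m(2) by (simp add: algebra_simps)
  qed
qed

definition \<delta>' :: real where "\<delta>' = \<delta> * (1 + 16 * real (k + 3) * \<delta>)"

text \<open>Knowing from \<open>crude_ratio\<close> that the delayed value exceeds the current one only by the factor
  \<open>1 / (1 - 8 * (k + 3) * \<delta>)\<close>, one more use of the recurrence improves the loss per step from
  \<open>8 * \<delta>\<close> to \<open>\<delta>\<close> plus a quadratic term.\<close>

lemma sharp_ratio:
  assumes "k + 3 \<le> n"
  shows "(1 - \<delta>') * q n \<le> q (Suc n)"
proof -
  define m where "m = n - (k + 2)"
  define x where "x = 8 * real (k + 3) * \<delta>"
  have x: "0 \<le> x" "x \<le> 1 / 2" using \<delta>_small \<delta>_pos by (auto simp: x_def algebra_simps)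
  have m: "0 < m" "n = m + (k + 2)" using assms by (auto simp: m_def)
  have "(1 - x) * q m \<le> (1 - 8 * real (k + 2) * \<delta>) * q m"
    using \<delta>_pos nonneg by (intro mult_right_mono) (auto simp: x_def)
  also have "\<dots> \<le> (1 - 8 * \<delta>) ^ (k + 2) * q m"
    using Bernoulli_k nonneg by (rule mult_right_mono)
  also have "\<dots> \<le> q n"
    unfolding m(2) using m \<delta>_le by (intro power_chain crude_ratio) auto
  finally have 1: "(1 + 2 * x) * ((1 - x) * q m) \<le> (1 + 2 * x) * q n"
    using x by (intro mult_left_mono) auto
  have "0 \<le> x * (1 - 2 * x)" using x by simp
  then have "1 \<le> (1 + 2 * x) * (1 - x)" by (simp add: algebra_simps)
  then have "1 * q m \<le> ((1 + 2 * x) * (1 - x)) * q m" by (rule mult_right_mono) (rule nonneg)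
  with 1 have "q m \<le> (1 + 2 * x) * q n" by (simp add: mult.assoc)
  then have "\<delta> * q m \<le> \<delta> * ((1 + 2 * x) * q n)" using \<delta>_pos by (intro mult_left_mono) auto
  moreover have "\<delta>' = \<delta> * (1 + 2 * x)" by (simp add: \<delta>'_def x_def)
  ultimately show ?thesis using rec_Suc[of n] m(2) by (simp add: algebra_simps)
qed

lemma \<delta>'_bounds: "0 \<le> \<delta>'" "\<delta>' \<le> 1 / 2"
  "\<delta>' + 2 * \<delta>'\<^sup>2 \<le> \<delta> + 18 * real (k + 3) * \<delta>\<^sup>2"
proof -
  show "0 \<le> \<delta>'" using \<delta>_pos by (simp add: \<delta>'_def)
  have le: "\<delta>' \<le> 2 * \<delta>"
    using mult_left_mono[of "1 + 16 * real (k + 3) * \<delta>" 2 \<delta>] \<delta>_small \<delta>_pos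
    by (simp add: \<delta>'_def)
  then show "\<delta>' \<le> 1 / 2" using \<delta>_le by simp
  have "\<delta>'\<^sup>2 \<le> (2 * \<delta>)\<^sup>2" using le \<open>0 \<le> \<delta>'\<close> by (rule power_mono)
  then have "2 * \<delta>'\<^sup>2 \<le> 8 * \<delta>\<^sup>2" by (simp add: power2_eq_square)
  also have "\<dots> \<le> 2 * real (k + 3) * \<delta>\<^sup>2" using k by (intro mult_right_mono) auto
  finally show "\<delta>' + 2 * \<delta>'\<^sup>2 \<le> \<delta> + 18 * real (k + 3) * \<delta>\<^sup>2"
    by (simp add: \<delta>'_def algebra_simps power2_eq_square)
qed

lemma lower_bound_power:
  assumes "0 < n"
  shows "(1 - 8 * \<delta>) * (1 - \<delta>') ^ n \<le> q n"
proof (cases "k + 3 \<le> n")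
  case True
  have "(1 - 8 * \<delta>) * (1 - \<delta>') ^ n \<le> (1 - 8 * \<delta>) * (1 - \<delta>') ^ (n - (k + 3))"
    using \<delta>'_bounds \<delta>_le True by (intro mult_left_mono power_decreasing) auto
  also have "\<dots> \<le> q (k + 3) * (1 - \<delta>') ^ (n - (k + 3))"
    using \<delta>'_bounds \<delta>_pos rec[of 0] q_0 q_Suc_Suc_k by (intro mult_right_mono) auto
  also have "\<dots> = (1 - \<delta>') ^ (n - (k + 3)) * q (k + 3)" by simp
  also have "\<dots> \<le> q (k + 3 + (n - (k + 3)))"
    using \<delta>'_bounds sharp_ratio by (intro power_chain) auto
  finally show ?thesis using True by simp
next
  case False
  then have "1 - 8 * \<delta> \<le> q n"
    using assms q_small[of n] q_Suc_k q_Suc_Suc_k \<delta>_pos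
    by (cases "n \<le> k"; cases "n = Suc k"; cases "n = k + 2") auto
  moreover have "(1 - 8 * \<delta>) * (1 - \<delta>') ^ n \<le> (1 - 8 * \<delta>) * 1"
    using \<delta>'_bounds \<delta>_le by (intro mult_left_mono power_le_one) auto
  ultimately show ?thesis by simp
qed

lemma lower_bound:
  assumes "0 < n"
  shows "exp (- \<delta> * real n) - 18 * real n * real (k + 3) * \<delta>\<^sup>2 - 8 * \<delta> \<le> q n"
proof -
  define y where "y = 18 * real n * real (k + 3) * \<delta>\<^sup>2"
  have y: "0 \<le> y" by (simp add: y_def)
  have "exp (- (\<delta> + 18 * real (k + 3) * \<delta>\<^sup>2)) \<le> exp (- \<delta>' - 2 * \<delta>'\<^sup>2)"
    using \<delta>'_bounds by simp
  also have "\<dots> \<le> exp (ln (1 - \<delta>'))"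
    unfolding exp_le_cancel_iff using ln_one_minus_pos_lower_bound[of \<delta>'] \<delta>'_bounds by simp
  also have "\<dots> = 1 - \<delta>'" using \<delta>'_bounds by (intro exp_ln) simp
  finally have "exp (- (\<delta> + 18 * real (k + 3) * \<delta>\<^sup>2)) ^ n \<le> (1 - \<delta>') ^ n"
    by (rule power_mono) simp
  moreover have "exp (- (\<delta> + 18 * real (k + 3) * \<delta>\<^sup>2)) ^ n = exp (- \<delta> * real n) * exp (- y)"
    by (simp add: exp_of_nat_mult[symmetric] exp_add[symmetric] y_def algebra_simps)
  ultimately have 1: "exp (- \<delta> * real n) * exp (- y) \<le> (1 - \<delta>') ^ n" by simp
  have le1: "exp (- \<delta> * real n) \<le> 1" using \<delta>_pos by simp
  have "exp (- \<delta> * real n) - y \<le> exp (- \<delta> * real n) - exp (- \<delta> * real n) * y"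
    using mult_right_mono[OF le1 y] by simp
  also have "\<dots> = exp (- \<delta> * real n) * (1 - y)" by (simp add: algebra_simps)
  also have "\<dots> \<le> exp (- \<delta> * real n) * exp (- y)"
    using exp_ge_add_one_self[of "- y"] by (intro mult_left_mono) auto
  also note 1
  finally have 2: "exp (- \<delta> * real n) - y \<le> (1 - \<delta>') ^ n" .
  have "(1 - \<delta>') ^ n * (8 * \<delta>) \<le> 1 * (8 * \<delta>)"
    using \<delta>'_bounds \<delta>_pos by (intro mult_right_mono power_le_one) auto
  with 2 lower_bound_power[OF assms] show ?thesis by (simp add: algebra_simps y_def)
qed

text \<open>The linear error \<open>1 / 2^k\<close> comes from the irregular first values and the start of the decay
  near \<open>2 * k\<close>, the error \<open>n / 4^k\<close> from \<open>n\<close> steps with a quadratic error in \<open>\<delta>\<close> each.\<close>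

lemma exp_approximation:
  assumes "0 < n"
  shows "\<bar>q n - exp (- \<delta> * real n)\<bar> \<le> real (k + 3) * (real n / 4 ^ k + 1 / 2 ^ k)"
proof -
  define y where "y = 2 * real (k + 2) * \<delta>"
  have y: "0 \<le> y" "y \<le> 1" using \<delta>_small \<delta>_pos by (auto simp: y_def algebra_simps)
  have "q n \<le> exp (- \<delta> * real n) * exp y"
    using upper_bound[OF assms] by (simp add: exp_add[symmetric] y_def algebra_simps)
  also have "\<dots> \<le> exp (- \<delta> * real n) * (1 + 2 * y)"
    using y exp_bound[of y] mult_left_mono[of y 1 y]
    by (intro mult_left_mono) (auto simp: power2_eq_square)
  also have "\<dots> = exp (- \<delta> * real n) + exp (- \<delta> * real n) * (2 * y)" by (simp add: algebra_simps)
  also have "exp (- \<delta> * real n) * (2 * y) \<le> 1 * (2 * y)"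
    using \<delta>_pos y by (intro mult_right_mono) auto
  finally have upper: "q n \<le> exp (- \<delta> * real n) + 2 * y" by simp
  have \<delta>k: "\<delta> = 1 / 2 ^ k / 8" "\<delta>\<^sup>2 = 1 / 4 ^ k / 64"
    by (simp_all add: \<delta>_def power_add power2_eq_square power_mult_distrib[symmetric])
  have a: "18 * real n * real (k + 3) * \<delta>\<^sup>2 \<le> real (k + 3) * (real n / 4 ^ k)"
  proof -
    have "18 / 64 * (real n * real (k + 3) / 4 ^ k) \<le> 1 * (real n * real (k + 3) / 4 ^ k)"
      by (rule mult_right_mono) simp_all
    moreover have "18 * real n * real (k + 3) * \<delta>\<^sup>2 = 18 / 64 * (real n * real (k + 3) / 4 ^ k)"
      unfolding \<delta>k(2) by simp
    ultimately show ?thesis by (simp add: mult.commute)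
  qed
  have "2 * y \<le> real (k + 3) * (8 * \<delta>)" "8 * \<delta> \<le> real (k + 3) * (8 * \<delta>)"
    using \<delta>_pos by (auto simp: y_def algebra_simps)
  then have b: "2 * y \<le> real (k + 3) * (1 / 2 ^ k)" "8 * \<delta> \<le> real (k + 3) * (1 / 2 ^ k)"
    by (simp_all add: \<delta>k)
  have "0 \<le> real (k + 3) * (real n / 4 ^ k)" by simp
  then show ?thesis
    using upper lower_bound[OF assms] a b unfolding distrib_left by linarith
qed

end

section \<open>From runs of ones to the longest run\<close>

lemma longest_run_le_iff: "longest_run xs \<le> k \<longleftrightarrow> \<not> (\<exists>a. sublist (replicate (Suc k) a) xs)"
proof -
  let ?K = "{k. \<exists>a. sublist (replicate k a) xs}"
  have "longest_run xs \<le> k \<longleftrightarrow> (\<forall>j\<in>?K. j \<le> k)"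
    unfolding longest_run_def by (rule Max_le_iff[OF finite_run_lengths run_lengths_nonempty])
  also have "\<dots> \<longleftrightarrow> Suc k \<notin> ?K"
  proof
    assume *: "Suc k \<notin> ?K"
    show "\<forall>j\<in>?K. j \<le> k"
    proof (rule ballI, rule ccontr)
      fix j assume "j \<in> ?K" "\<not> j \<le> k"
      then obtain a where a: "sublist (replicate j a) xs" "Suc k \<le> j" by auto
      have "sublist (replicate (Suc k) a) (replicate j a)"
        using a(2) by (intro prefix_imp_sublist prefix_replicate_le[OF _ prefix_order.refl])
      with a(1) have "sublist (replicate (Suc k) a) xs" using sublist_order.order.trans by blast
      with * show False by blast
    qed
  next
    assume "\<forall>j\<in>?K. j \<le> k"
    then show "Suc k \<notin> ?K" by (meson Suc_n_not_le_n)
  qed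
  finally show ?thesis by simp
qed

text \<open>A union bound over the size of what precedes the block.\<close>

lemma card_compositions_containing:
  "real (card {xs \<in> compositions n. sublist ys xs}) \<le> (real n + 1) * 2 ^ n / 2 ^ sum_list ys"
proof (cases "sum_list ys \<le> n")
  case True
  define r where "r = n - sum_list ys"
  let ?f = "\<lambda>(us, vs). us @ ys @ vs"
  have "{xs \<in> compositions n. sublist ys xs} \<subseteq>
          (\<Union>i\<le>r. ?f ` (compositions i \<times> compositions (r - i)))" (is "_ \<subseteq> ?U")
  proof
    fix xs assume "xs \<in> {xs \<in> compositions n. sublist ys xs}"
    then obtain us vs where "xs = us @ ys @ vs" "xs \<in> compositions n"
      by (auto simp: sublist_def)
    then have "xs = ?f (us, vs)" "us \<in> compositions (sum_list us)"
      "vs \<in> compositions (r - sum_list us)" "sum_list us \<le> r"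
      by (auto simp: compositions_def r_def)
    then show "xs \<in> ?U" by blast
  qed
  then have "card {xs \<in> compositions n. sublist ys xs} \<le> card ?U"
    by (intro card_mono) (auto simp: finite_compositions)
  also have "\<dots> \<le> (\<Sum>i\<le>r. card (?f ` (compositions i \<times> compositions (r - i))))"
    by (rule card_UN_le) simp
  also have "\<dots> \<le> (\<Sum>i\<le>r. 2 ^ r)"
  proof (rule sum_mono)
    fix i assume "i \<in> {..r}"
    have "card (?f ` (compositions i \<times> compositions (r - i)))
            \<le> card (compositions i) * card (compositions (r - i))"
      by (metis card_cartesian_product card_image_le finite_SigmaI finite_compositions)
    also have "\<dots> \<le> 2 ^ i * 2 ^ (r - i)" by (intro mult_mono card_compositions_le) auto
    also have "\<dots> = 2 ^ r" using \<open>i \<in> {..r}\<close> by (simp add: power_add[symmetric])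
    finally show "card (?f ` (compositions i \<times> compositions (r - i))) \<le> 2 ^ r" .
  qed
  finally have "card {xs \<in> compositions n. sublist ys xs} \<le> (r + 1) * 2 ^ r" by simp
  then have "real (card {xs \<in> compositions n. sublist ys xs}) \<le> real ((r + 1) * 2 ^ r)"
    by (rule of_nat_mono)
  also have "\<dots> = (real r + 1) * 2 ^ r" by (simp add: algebra_simps)
  also have "(2 :: real) ^ r = 2 ^ n / 2 ^ sum_list ys"
    unfolding r_def using True by (intro power_diff) auto
  also have "(real r + 1) * (2 ^ n / 2 ^ sum_list ys) = (real r + 1) * 2 ^ n / 2 ^ sum_list ys"
    by simp
  also have "\<dots> \<le> (real n + 1) * 2 ^ n / 2 ^ sum_list ys"
    by (intro divide_right_mono mult_right_mono) (auto simp: r_def)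
  finally show ?thesis .
next
  case False
  then have "{xs \<in> compositions n. sublist ys xs} = {}"
    by (auto simp: compositions_def sublist_def)
  then show ?thesis by (simp only: card.empty) simp
qed

definition short_runs :: "nat \<Rightarrow> nat \<Rightarrow> nat list set" where
  "short_runs k n = {xs \<in> compositions n. longest_run xs \<le> k}"

lemma finite_short_runs [simp]: "finite (short_runs k n)"
  by (simp add: short_runs_def finite_compositions)

lemma short_runs_subset: "short_runs k n \<subseteq> ones_bounded k n"
  by (auto simp: short_runs_def ones_bounded_def longest_run_le_iff simp del: replicate.simps)

lemma sum_power_from_2_le:
  fixes x :: real
  assumes "0 \<le> x" "x \<le> 1 / 2"
  shows "(\<Sum>a = 2..n. x ^ a) \<le> 2 * x\<^sup>2"
proof -
  \<comment> \<open>The additional summand bounds the rest of the geometric series and carries the induction.\<close>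
  have step: "(\<Sum>a = 2..Suc m. x ^ a) + 2 * x ^ (m + 2) \<le> 2 * x\<^sup>2" for m
  proof (induction m)
    case (Suc m)
    have "x ^ (m + 2) * (2 * x) \<le> x ^ (m + 2) * 1"
      using assms by (intro mult_left_mono) auto
    moreover have "2 * x ^ (Suc m + 2) = x ^ (m + 2) * (2 * x)" by simp
    moreover have "(\<Sum>a = 2..Suc (Suc m). x ^ a) = (\<Sum>a = 2..Suc m. x ^ a) + x ^ (m + 2)" by simp
    ultimately show ?case using Suc by linarith
  qed (simp add: power2_eq_square)
  show ?thesis
  proof (cases n)
    case (Suc m)
    have "0 \<le> x ^ (m + 2)" using assms by (intro zero_le_power)
    with step[of m] show ?thesis unfolding Suc by linarith
  qed simp
qed

text \<open>Runs of more than \<open>k\<close> equal parts \<open>a \<ge> 2\<close> take up size at least \<open>2 * (k + 1)\<close>, hence the decay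
  \<open>1 / 4^k\<close>; the sum over \<open>a\<close> is geometric.\<close>

lemma card_ones_bounded_minus_short_runs:
  "real (card (ones_bounded k n)) - real (card (short_runs k n)) \<le> (real n + 1) * 2 ^ n / (2 * 4 ^ k)"
proof -
  have sub: "ones_bounded k n - short_runs k n \<subseteq>
          (\<Union>a\<in>{2..n}. {xs \<in> compositions n. sublist (replicate (Suc k) a) xs})" (is "_ \<subseteq> ?U")
  proof
    fix xs assume "xs \<in> ones_bounded k n - short_runs k n"
    then obtain a where xs: "xs \<in> compositions n" "\<not> sublist (replicate (Suc k) 1) xs"
        and a: "sublist (replicate (Suc k) a) xs"
      by (auto simp: short_runs_def ones_bounded_def longest_run_le_iff simp del: replicate.simps)
    have "a \<in> set xs" using set_mono_sublist[OF a] by auto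
    with xs(1) have "0 < a" "a \<le> n" by (auto simp: compositions_def intro: member_le_sum_list)
    moreover have "a \<noteq> 1" using xs(2) a by blast
    ultimately have "a \<in> {2..n}" by auto
    with xs a show "xs \<in> ?U" by blast
  qed
  have "real (card (ones_bounded k n)) - real (card (short_runs k n)) =
          real (card (ones_bounded k n - short_runs k n))"
    using card_Diff_subset[OF finite_short_runs short_runs_subset, of k n]
      card_mono[OF finite_ones_bounded short_runs_subset, of k n] by (simp add: of_nat_diff)
  also have "\<dots> \<le> real (card ?U)"
    using sub by (intro of_nat_mono card_mono) (auto simp: finite_compositions)
  also have "\<dots> \<le> (\<Sum>a = 2..n. real (card {xs \<in> compositions n. sublist (replicate (Suc k) a) xs}))"
  proof -
    have "card ?U \<le> (\<Sum>a = 2..n. card {xs \<in> compositions n. sublist (replicate (Suc k) a) xs})"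
      by (rule card_UN_le) simp
    then have "real (card ?U) \<le> real (\<Sum>a = 2..n. card {xs \<in> compositions n. sublist (replicate (Suc k) a) xs})"
      by (rule of_nat_mono)
    then show ?thesis by (simp only: of_nat_sum)
  qed
  also have "\<dots> \<le> (\<Sum>a = 2..n. (real n + 1) * 2 ^ n * (1 / 2 ^ Suc k) ^ a)"
  proof (rule sum_mono)
    fix a
    have "real (card {xs \<in> compositions n. sublist (replicate (Suc k) a) xs})
            \<le> (real n + 1) * 2 ^ n / 2 ^ (Suc k * a)"
      using card_compositions_containing[of n "replicate (Suc k) a"]
      by (simp add: sum_list_replicate del: replicate.simps)
    then show "real (card {xs \<in> compositions n. sublist (replicate (Suc k) a) xs})
            \<le> (real n + 1) * 2 ^ n * (1 / 2 ^ Suc k) ^ a"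
      by (simp only: power_mult power_divide power_one times_divide_eq_right mult_1_right)
  qed
  also have "\<dots> = (real n + 1) * 2 ^ n * (\<Sum>a = 2..n. (1 / 2 ^ Suc k) ^ a)"
    by (simp add: sum_distrib_left)
  also have "\<dots> \<le> (real n + 1) * 2 ^ n * (2 * (1 / 2 ^ Suc k)\<^sup>2)"
    by (intro mult_left_mono sum_power_from_2_le) (auto simp: field_simps)
  also have "(1 / 2 ^ Suc k)\<^sup>2 = 1 / (4 * 4 ^ k :: real)"
    by (simp add: power2_eq_square power_mult_distrib[symmetric])
  finally show ?thesis by simp
qed

text \<open>The factor 2 turns \<open>2^n\<close> into the number \<open>2^(n - 1)\<close> of compositions of size \<open>n \<ge> 1\<close>.\<close>

definition short_runs_prob :: "nat \<Rightarrow> nat \<Rightarrow> real" where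
  "short_runs_prob k n = 2 * real (card (short_runs k n)) / 2 ^ n"

definition ones_bounded_prob :: "nat \<Rightarrow> nat \<Rightarrow> real" where
  "ones_bounded_prob k n = 2 * real (card (ones_bounded k n)) / 2 ^ n"

lemma delayed_recurrence_ones_bounded_prob:
  assumes "4 \<le> k"
  shows "delayed_recurrence (ones_bounded_prob k) k"
proof
  fix m
  have "real (card (ones_bounded k (m + k + 3))) + real (card (ones_bounded k m))
          = 2 * real (card (ones_bounded k (m + k + 2)))"
    using card_ones_bounded_rec[of k m] by (metis of_nat_add of_nat_mult of_nat_numeral)
  then have "real (card (ones_bounded k (m + k + 3)))
          = 2 * real (card (ones_bounded k (m + k + 2))) - real (card (ones_bounded k m))" by simp
  then show "ones_bounded_prob k (m + k + 3) =
      ones_bounded_prob k (m + k + 2) - 1 / 2 ^ (k + 3) * ones_bounded_prob k m"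
    unfolding ones_bounded_prob_def by (simp add: power_add field_simps)
next
  show "ones_bounded_prob k (Suc k) = 1 - 8 * (1 / 2 ^ (k + 3))"
    by (simp add: ones_bounded_prob_def card_ones_bounded_Suc_k of_nat_diff power_add field_simps)
  show "ones_bounded_prob k (k + 2) = 1 - 4 * (1 / 2 ^ (k + 3))"
    using card_ones_bounded_Suc_Suc_k[of k] assms 
    by (simp add: ones_bounded_prob_def of_nat_diff power_add field_simps)
next
  fix n assume "0 < n" "n \<le> k"
  then show "ones_bounded_prob k n = 1"
    using card_ones_bounded_small[of n k] by (cases n) (simp_all add: ones_bounded_prob_def)
qed (use assms in \<open>auto simp: ones_bounded_prob_def card_ones_bounded_0\<close>)

lemma short_runs_prob_le: "short_runs_prob k n \<le> ones_bounded_prob k n"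
  using card_mono[OF finite_ones_bounded short_runs_subset, of k n]
  by (simp add: short_runs_prob_def ones_bounded_prob_def divide_right_mono)

lemma ones_bounded_prob_minus_short_runs_prob:
  "ones_bounded_prob k n - short_runs_prob k n \<le> (real n + 1) / 4 ^ k"
proof -
  have "ones_bounded_prob k n - short_runs_prob k n =
          2 / 2 ^ n * (real (card (ones_bounded k n)) - real (card (short_runs k n)))"
    by (simp add: short_runs_prob_def ones_bounded_prob_def algebra_simps diff_divide_distrib)
  also have "\<dots> \<le> 2 / 2 ^ n * ((real n + 1) * 2 ^ n / (2 * 4 ^ k))"
    by (intro mult_left_mono card_ones_bounded_minus_short_runs) simp
  also have "\<dots> = (real n + 1) / 4 ^ k" by (simp add: divide_simps)
  finally show ?thesis .
qed

lemma short_runs_prob_approximation: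
  assumes "0 < n" "4 \<le> k"
  shows "\<bar>short_runs_prob k n - exp (- (real n / 2 ^ (k + 3)))\<bar>
           \<le> real (k + 3) * (3 * real n / 4 ^ k + 1 / 2 ^ k)"
proof -
  interpret delayed_recurrence "ones_bounded_prob k" k "1 / 2 ^ (k + 3)"
    using delayed_recurrence_ones_bounded_prob[OF assms(2)] by simp_all
  have 1: "\<bar>ones_bounded_prob k n - exp (- (real n / 2 ^ (k + 3)))\<bar> \<le>
      real (k + 3) * (real n / 4 ^ k + 1 / 2 ^ k)"
    using exp_approximation[OF assms(1)] by simp
  have "(real n + 1) / 4 ^ k \<le> 2 * real n / 4 ^ k"
    using assms by (intro divide_right_mono) auto
  also have "\<dots> \<le> real (k + 3) * (2 * real n / 4 ^ k)"
    using mult_right_mono[of 1 "real (k + 3)" "2 * real n / 4 ^ k"] by simp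
  finally have "\<bar>short_runs_prob k n - ones_bounded_prob k n\<bar> \<le> real (k + 3) * (2 * real n / 4 ^ k)"
    using short_runs_prob_le[of k n] ones_bounded_prob_minus_short_runs_prob[of k n] by linarith
  with 1 have "\<bar>short_runs_prob k n - exp (- (real n / 2 ^ (k + 3)))\<bar> \<le>
      real (k + 3) * (real n / 4 ^ k + 1 / 2 ^ k) + real (k + 3) * (2 * real n / 4 ^ k)" by linarith
  also have "\<dots> = real (k + 3) * (3 * real n / 4 ^ k + 1 / 2 ^ k)"
    unfolding distrib_left[symmetric] by (simp add: add_divide_distrib[symmetric])
  finally show ?thesis .
qed

lemma short_runs_prob_upper_bound:
  assumes "0 < n" "4 \<le> k"
  shows "short_runs_prob k n \<le> exp (- ((real n - 2 * real k - 4) / 2 ^ (k + 3)))"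
proof -
  interpret delayed_recurrence "ones_bounded_prob k" k "1 / 2 ^ (k + 3)"
    using delayed_recurrence_ones_bounded_prob[OF assms(2)] by simp_all
  show ?thesis using upper_bound[OF assms(1)] short_runs_prob_le[of k n] by simp
qed

section \<open>The expectation as a sum of tail probabilities\<close>

lemma longest_run_le_length: "longest_run xs \<le> length xs"
  unfolding longest_run_le_iff by (auto dest!: sublist_length_le simp del: replicate.simps)

lemma length_le_size: "xs \<in> compositions n \<Longrightarrow> length xs \<le> n"
proof (induction xs arbitrary: n)
  case (Cons x xs)
  then show ?case by (force simp: Cons_in_compositions)
qed simp

lemma longest_run_le_size: "xs \<in> compositions n \<Longrightarrow> longest_run xs \<le> n"
  using longest_run_le_length[of xs] length_le_size[of xs n] by simp

lemma short_runs_prob_eq: "0 < n \<Longrightarrow> short_runs_prob k n = real (card (short_runs k n)) / card (compositions n)"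
  by (cases n) (simp_all add: short_runs_prob_def card_compositions_Suc)

lemma short_runs_prob_eq_1:
  assumes "0 < n" "n \<le> k"
  shows "short_runs_prob k n = 1"
proof -
  have "short_runs k n = compositions n"
    using longest_run_le_size assms(2) by (fastforce simp: short_runs_def)
  then show ?thesis
    using assms finite_compositions[of n] compositions_nonempty[of n] by (simp add: short_runs_prob_eq)
qed

lemma short_runs_prob_mono: "j \<le> k \<Longrightarrow> short_runs_prob j n \<le> short_runs_prob k n"
  unfolding short_runs_prob_def
  by (intro divide_right_mono mult_left_mono of_nat_mono card_mono) (auto simp: short_runs_def finite_compositions)

lemma short_runs_prob_nonneg: "0 \<le> short_runs_prob k n"
  by (simp add: short_runs_prob_def)

lemma expectation_longest_run:
  assumes "0 < n"
  shows "composition_expectation n (\<lambda>xs. real (longest_run xs)) = (\<Sum>k<n. 1 - short_runs_prob k n)"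
proof -
  have pos: "card (compositions n) > 0"
    using finite_compositions compositions_nonempty by (simp add: card_gt_0_iff)
  have "composition_expectation n (\<lambda>xs. real (longest_run xs)) =
          (\<Sum>xs\<in>compositions n. real (longest_run xs)) / card (compositions n)"
    unfolding composition_expectation_def
    by (rule integral_pmf_of_set[OF compositions_nonempty finite_compositions])
  also have "(\<Sum>xs\<in>compositions n. real (longest_run xs)) =
               (\<Sum>xs\<in>compositions n. \<Sum>k<n. 1 - of_bool (longest_run xs \<le> k))"
  proof (rule sum.cong[OF refl])
    fix xs assume "xs \<in> compositions n"
    then have "{..<n} \<inter> {k. longest_run xs \<le> k} = {longest_run xs..<n}" "longest_run xs \<le> n"
      using longest_run_le_size by auto
    then show "real (longest_run xs) = (\<Sum>k<n. 1 - of_bool (longest_run xs \<le> k))"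
      by (simp add: sum_subtractf of_bool_def sum.If_cases of_nat_diff)
  qed
  also have "\<dots> = (\<Sum>k<n. \<Sum>xs\<in>compositions n. 1 - of_bool (longest_run xs \<le> k))"
    by (rule sum.swap)
  also have "\<dots> = (\<Sum>k<n. real (card (compositions n)) - real (card (short_runs k n)))"
    by (simp add: sum_subtractf of_bool_def sum.If_cases finite_compositions short_runs_def Int_def)
  also have "\<dots> / card (compositions n) = (\<Sum>k<n. 1 - short_runs_prob k n)"
    using pos assms by (simp add: sum_divide_distrib diff_divide_distrib short_runs_prob_eq)
  finally show ?thesis .
qed

section \<open>The expectation as a sum over dyadic scales\<close>

definition doubling_sum :: "real \<Rightarrow> real" where
  "doubling_sum x = (\<Sum>k. 1 - exp (- (x / 2 ^ k)))"

lemma one_minus_exp_bounds: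
  fixes y :: real
  assumes "0 \<le> y"
  shows "0 \<le> 1 - exp (- y)" "1 - exp (- y) \<le> y"
  using assms exp_ge_add_one_self[of "- y"] by auto

lemma summable_div_power_2: "summable (\<lambda>k. x / 2 ^ k :: real)"
  using summable_mult[OF summable_geometric[of "1/2 :: real"], of x] by (simp add: power_divide)

lemma summable_doubling_sum:
  fixes x :: real
  assumes "0 \<le> x"
  shows "summable (\<lambda>k. 1 - exp (- (x / 2 ^ k)))"
  by (rule summable_comparison_test'[OF summable_div_power_2[of x], of 0])
     (use one_minus_exp_bounds[of "x / 2 ^ k" for k] assms in \<open>auto simp: abs_le_iff\<close>)

text \<open>At scales \<open>k \<ge> k\<^sub>0\<close> the exponential approximation is used term by term. For \<open>k < k\<^sub>0\<close> it is too
  weak, but there the probability and the exponential increase with \<open>k\<close>, so that the small upper bound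
  at \<open>k\<^sub>0\<close> holds for both.\<close>

lemma expectation_longest_run_approximation:
  assumes "0 < n" "4 \<le> k\<^sub>0"
  shows "\<bar>composition_expectation n (\<lambda>xs. real (longest_run xs)) - doubling_sum (real n / 8)\<bar>
           \<le> real k\<^sub>0 * exp (- ((real n - 2 * real k\<^sub>0 - 4) / 2 ^ (k\<^sub>0 + 3))) +
             4 * real (k\<^sub>0 + 3) * (3 * real n / 4 ^ k\<^sub>0 + 1 / 2 ^ k\<^sub>0)"
proof -
  define f where "f k = short_runs_prob k n" for k
  define g where "g k = exp (- (real n / 8 / 2 ^ k))" for k
  define c where "c = real (k\<^sub>0 + 3) * (3 * real n / 4 ^ k\<^sub>0 + 1 / 2 ^ k\<^sub>0)"
  define e where "e = exp (- ((real n - 2 * real k\<^sub>0 - 4) / 2 ^ (k\<^sub>0 + 3)))"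
  have "(\<lambda>k. 1 - f k) sums (\<Sum>k<n. 1 - f k)"
    using assms(1) short_runs_prob_eq_1 by (intro sums_finite) (auto simp: f_def not_less)
  moreover have "(\<lambda>k. 1 - g k) sums doubling_sum (real n / 8)"
    unfolding g_def doubling_sum_def by (intro summable_sums summable_doubling_sum) simp
  ultimately have diff: "(\<lambda>k. g k - f k) sums
      (composition_expectation n (\<lambda>xs. real (longest_run xs)) - doubling_sum (real n / 8))"
    using sums_diff[of "\<lambda>k. 1 - f k" _ "\<lambda>k. 1 - g k"] expectation_longest_run[OF assms(1)]
    by (simp add: f_def)
  have tail: "\<bar>g (j + k\<^sub>0) - f (j + k\<^sub>0)\<bar> \<le> c * (real (Suc j) * (1 / 2) ^ j)" for j
  proof -
    have "\<bar>g (j + k\<^sub>0) - f (j + k\<^sub>0)\<bar>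
            \<le> real (j + k\<^sub>0 + 3) * (3 * real n / 4 ^ (j + k\<^sub>0) + 1 / 2 ^ (j + k\<^sub>0))"
      using short_runs_prob_approximation[OF assms(1), of "j + k\<^sub>0"] assms(2)
      by (simp add: f_def g_def abs_minus_commute power_add ac_simps)
    also have "\<dots> \<le> (real (k\<^sub>0 + 3) * real (Suc j)) *
                      ((3 * real n / 4 ^ k\<^sub>0 + 1 / 2 ^ k\<^sub>0) * (1 / 2) ^ j)"
    proof (intro mult_mono)
      show "real (j + k\<^sub>0 + 3) \<le> real (k\<^sub>0 + 3) * real (Suc j)" by (simp add: algebra_simps)
      have "3 * real n / 4 ^ k\<^sub>0 * (1 / 4) ^ j \<le> 3 * real n / 4 ^ k\<^sub>0 * (1 / 2) ^ j"
        by (intro mult_left_mono power_mono) auto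
      moreover have "3 * real n / 4 ^ (j + k\<^sub>0) + 1 / 2 ^ (j + k\<^sub>0) =
          3 * real n / 4 ^ k\<^sub>0 * (1 / 4) ^ j + 1 / 2 ^ k\<^sub>0 * (1 / 2) ^ j"
        by (simp add: power_add power_divide mult.commute)
      ultimately show "3 * real n / 4 ^ (j + k\<^sub>0) + 1 / 2 ^ (j + k\<^sub>0) \<le>
                   (3 * real n / 4 ^ k\<^sub>0 + 1 / 2 ^ k\<^sub>0) * (1 / 2) ^ j"
        unfolding distrib_right by linarith
    qed auto
    finally show ?thesis by (simp add: c_def ac_simps)
  qed
  have head: "\<bar>g k - f k\<bar> \<le> e" if "k < k\<^sub>0" for k
  proof -
    have "f k \<le> f k\<^sub>0" using that by (simp add: f_def short_runs_prob_mono)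
    also have "\<dots> \<le> e" using short_runs_prob_upper_bound[OF assms] by (simp add: f_def e_def)
    finally have "f k \<le> e" .
    have "(real n - 2 * real k\<^sub>0 - 4) / 2 ^ (k\<^sub>0 + 3) \<le> real n / 2 ^ (k\<^sub>0 + 3)"
      by (intro divide_right_mono) auto
    also have "\<dots> \<le> real n / 2 ^ (k + 3)"
      using that by (intro divide_left_mono power_increasing) auto
    finally have "g k \<le> e" by (simp add: g_def e_def power_add mult.commute)
    moreover have "0 \<le> f k" "0 \<le> g k" by (auto simp: f_def g_def short_runs_prob_nonneg)
    ultimately show ?thesis using \<open>f k \<le> e\<close> by linarith
  qed
  have geo: "(\<lambda>j. c * (real (Suc j) * (1 / 2) ^ j)) sums (c * 4)"
    using sums_mult[OF geometric_deriv_sums[of "1 / 2 :: real"], of c] by (simp add: power2_eq_square)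
  have sum_tail: "summable (\<lambda>j. \<bar>g (j + k\<^sub>0) - f (j + k\<^sub>0)\<bar>)"
    by (rule summable_comparison_test'[OF sums_summable[OF geo], of 0]) (use tail in simp)
  then have sum_abs: "summable (\<lambda>j. \<bar>g j - f j\<bar>)" by (subst (asm) summable_iff_shift)
  have "\<bar>suminf (\<lambda>k. g k - f k)\<bar> \<le> (\<Sum>k. \<bar>g k - f k\<bar>)" by (rule summable_rabs[OF sum_abs])
  also have "\<dots> = (\<Sum>j. \<bar>g (j + k\<^sub>0) - f (j + k\<^sub>0)\<bar>) + (\<Sum>k<k\<^sub>0. \<bar>g k - f k\<bar>)"
    by (rule suminf_split_initial_segment[OF sum_abs])
  also have "(\<Sum>k<k\<^sub>0. \<bar>g k - f k\<bar>) \<le> (\<Sum>k<k\<^sub>0. e)" using head by (intro sum_mono) auto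
  also have "(\<Sum>j. \<bar>g (j + k\<^sub>0) - f (j + k\<^sub>0)\<bar>) \<le> (\<Sum>j. c * (real (Suc j) * (1 / 2) ^ j))"
    by (rule suminf_le[OF tail sum_tail sums_summable[OF geo]])
  also have "(\<Sum>j. c * (real (Suc j) * (1 / 2) ^ j)) = c * 4" by (rule sums_unique[OF geo, symmetric])
  also have "(\<Sum>k<k\<^sub>0. e) = real k\<^sub>0 * e" by simp
  also have "suminf (\<lambda>k. g k - f k) =
      composition_expectation n (\<lambda>xs. real (longest_run xs)) - doubling_sum (real n / 8)"
    by (rule sums_unique[OF diff, symmetric])
  also have "c * 4 + real k\<^sub>0 * e = real k\<^sub>0 * e + 4 * real (k\<^sub>0 + 3) * (3 * real n / 4 ^ k\<^sub>0 + 1 / 2 ^ k\<^sub>0)"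
    by (simp add: c_def)
  finally show ?thesis unfolding e_def by simp
qed

text \<open>The threshold \<open>2^k\<^sub>0 \<approx> n^(3/4)\<close> balances the two errors: the scales below it contribute at
  most \<open>lg n * exp (- c * n^(1/4))\<close> with a constant \<open>c > 0\<close>, those above it \<open>ln n / sqrt n\<close> through
  \<open>n / 4^k\<^sub>0\<close>.\<close>

lemma expectation_longest_run_doubling_sum:
  "(\<lambda>n. composition_expectation n (\<lambda>xs. real (longest_run xs)) - doubling_sum (real n / 8))
     \<in> O(\<lambda>n. (ln (real n))\<^sup>2 / sqrt (real n))"
proof -
  define B where "B n = log 2 (real n) * exp (- ((real n - 2 * log 2 (real n) - 4) / (16 * real n powr (3/4)))) +
     4 * (log 2 (real n) + 3) * (3 * real n / real n powr (3/2) + 1 / real n powr (3/4))" for n :: nat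
  have le_B: "\<bar>composition_expectation n (\<lambda>xs. real (longest_run xs)) - doubling_sum (real n / 8)\<bar> \<le> B n"
    if n: "64 \<le> n" "2 * log 2 (real n) + 4 \<le> real n" for n
  proof -
    define L where "L = log 2 (real n)"
    \<comment> \<open>The least \<open>k\<^sub>0\<close> with \<open>2^k\<^sub>0 \<ge> n^(3/4)\<close>; it also satisfies \<open>2^k\<^sub>0 \<le> 2 * n^(3/4)\<close>.\<close>
    define k\<^sub>0 where "k\<^sub>0 = nat \<lceil>3 / 4 * L\<rceil>"
    have "log 2 (2 ^ 6) \<le> L" unfolding L_def using n(1) by (intro log_mono) auto
    moreover have "log 2 (2 ^ 6 :: real) = 6" by (subst log_pow_cancel) auto
    ultimately have L: "6 \<le> L" by linarith
    have k0: "3 / 4 * L \<le> real k\<^sub>0" "real k\<^sub>0 \<le> 3 / 4 * L + 1" using L by (auto simp: k\<^sub>0_def)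
    have powr_L: "2 powr (c * L) = real n powr c" for c
      using n(1) by (simp add: L_def mult.commute[of c] powr_powr[symmetric])
    have "real n powr (3/4) \<le> 2 powr real k\<^sub>0" 
      unfolding powr_L[symmetric] using k0 by (intro powr_mono) auto
    then have p1: "real n powr (3/4) \<le> 2 ^ k\<^sub>0" by (simp add: powr_realpow)
    have "2 powr real k\<^sub>0 \<le> 2 powr (3 / 4 * L + 1)" using k0 by (intro powr_mono) auto
    then have p2: "2 ^ k\<^sub>0 \<le> 2 * real n powr (3/4)" by (simp add: powr_realpow powr_add powr_L[of "3/4", simplified])
    have "real n powr (3/2) = (real n powr (3/4))\<^sup>2"
      using n(1) by (simp add: power2_eq_square powr_add[symmetric])
    also have "\<dots> \<le> (2 ^ k\<^sub>0)\<^sup>2" using p1 by (intro power_mono) auto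
    also have "\<dots> = 4 ^ k\<^sub>0" by (simp add: power2_eq_square power_mult_distrib[symmetric])
    finally have p3: "real n powr (3/2) \<le> 4 ^ k\<^sub>0" .
    have npos: "0 < real n powr c" for c using n(1) by simp
    have kL: "4 \<le> k\<^sub>0" "real k\<^sub>0 \<le> L" using k0 L by linarith+
    have "(real n - 2 * L - 4) / (16 * real n powr (3/4)) \<le> (real n - 2 * real k\<^sub>0 - 4) / 2 ^ (k\<^sub>0 + 3)"
      using p2 npos kL n(2) by (intro frac_le) (auto simp: power_add L_def)
    then have e: "real k\<^sub>0 * exp (- ((real n - 2 * real k\<^sub>0 - 4) / 2 ^ (k\<^sub>0 + 3)))
            \<le> L * exp (- ((real n - 2 * L - 4) / (16 * real n powr (3/4))))"
      using kL L by (intro mult_mono) auto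
    have "3 * real n / 4 ^ k\<^sub>0 + 1 / 2 ^ k\<^sub>0 \<le> 3 * real n / real n powr (3/2) + 1 / real n powr (3/4)"
      using p1 p3 npos by (intro add_mono divide_left_mono) auto
    then have "4 * real (k\<^sub>0 + 3) * (3 * real n / 4 ^ k\<^sub>0 + 1 / 2 ^ k\<^sub>0)
            \<le> 4 * (L + 3) * (3 * real n / real n powr (3/2) + 1 / real n powr (3/4))"
      using kL L by (intro mult_mono) auto
    with e expectation_longest_run_approximation[of n k\<^sub>0] n(1) kL show ?thesis
      unfolding B_def L_def by linarith
  qed
  have "eventually (\<lambda>n::nat. 2 * log 2 (real n) + 4 \<le> real n) at_top" by real_asymp
  with eventually_ge_at_top[of "64::nat"]
  have "eventually (\<lambda>n. \<bar>composition_expectation n (\<lambda>xs. real (longest_run xs)) - doubling_sum (real n / 8)\<bar> \<le> B n) at_top"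
    by eventually_elim (rule le_B)
  then have "eventually (\<lambda>n. norm (composition_expectation n (\<lambda>xs. real (longest_run xs)) - doubling_sum (real n / 8)) \<le> 1 * norm (B n)) at_top"
    by eventually_elim simp
  then have "(\<lambda>n. composition_expectation n (\<lambda>xs. real (longest_run xs)) - doubling_sum (real n / 8)) \<in> O(B)"
    by (rule bigoI)
  also have "B \<in> O(\<lambda>n. (ln (real n))\<^sup>2 / sqrt (real n))"
    unfolding B_def by real_asymp
  finally show ?thesis .
qed

section \<open>Uniqueness of Fourier coefficients\<close>

text \<open>The characters of the circle group of reals modulo 1.\<close>

definition circle_char :: "int \<Rightarrow> real \<Rightarrow> complex" where
  "circle_char k w = exp (2 * \<i> * of_int k * of_real pi * of_real w)"

lemma continuous_on_circle_char [continuous_intros]: "continuous_on A (circle_char k)"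
  unfolding circle_char_def by (intro continuous_intros)

lemma circle_char_mult: "circle_char j w * circle_char k w = circle_char (j + k) w"
  by (simp add: circle_char_def exp_add[symmetric] algebra_simps)

lemma circle_char_0 [simp]: "circle_char 0 w = 1"
  by (simp add: circle_char_def)

lemma norm_circle_char [simp]: "norm (circle_char k w) = 1"
proof -
  have "2 * \<i> * of_int k * of_real pi * of_real w = \<i> * of_real (2 * real_of_int k * pi * w)" by simp
  then show ?thesis unfolding circle_char_def by (simp only: norm_exp_i_times)
qed

lemma circle_char_add_int [simp]: "circle_char k (w + of_int n) = circle_char k w"
proof -
  have "circle_char k (w + of_int n) = circle_char k w * exp (of_int (k * n) * (2 * of_real pi * \<i>))"
    by (simp add: circle_char_def exp_add[symmetric] algebra_simps)
  also have "exp (of_int (k * n) * (2 * of_real pi * \<i>)) = 1"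
    using exp_integer_2pi[of "of_int (k * n)"] by (simp add: mult_ac)
  finally show ?thesis by simp
qed

lemma has_integral_circle_char: "(circle_char k has_integral of_bool (k = 0)) {0..1}"
proof (cases "k = 0")
  case True
  have "circle_char 0 = (\<lambda>_. 1)" by (rule ext) simp
  with True show ?thesis using has_integral_const_real[of "1 :: complex" 0 1] by simp
next
  case False
  define a where "a = 2 * \<i> * of_int k * complex_of_real pi"
  have a: "a \<noteq> 0" using False by (simp add: a_def)
  have "((\<lambda>w. exp (a * of_real w) / a) has_vector_derivative exp (a * of_real w)) (at w within {0..1})" for w
    using a by (auto intro!: derivative_eq_intros has_vector_derivative_real_field)
  then have "((\<lambda>w. exp (a * of_real w)) has_integral (exp (a * of_real 1) / a - exp (a * of_real 0) / a)) {0..1}"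
    by (intro fundamental_theorem_of_calculus) auto
  moreover have "exp a = 1" using circle_char_add_int[of k 0 1] by (simp add: circle_char_def a_def)
  moreover have "circle_char k = (\<lambda>w. exp (a * of_real w))" by (rule ext) (simp add: circle_char_def a_def)
  ultimately show ?thesis using False by simp
qed

lemma periodic_int:
  fixes f :: "real \<Rightarrow> 'a"
  assumes "\<And>w. f (w + 1) = f w"
  shows "f (w + of_int n) = f w"
proof (induction n rule: int_induct[of _ 0])
  case (step1 i)
  then show ?case using assms[of "w + of_int i"] by (simp add: add.assoc)
next
  case (step2 i)
  then show ?case using assms[of "w + of_int (i - 1)"] by simp
qed simp

text \<open>The two branches \<open>Arg\<close> and \<open>Arg2pi\<close> of the argument agree modulo \<open>2 * pi\<close>, so either may be
  used to lift \<open>f\<close>, and each point of the circle is a point of continuity of one of them.\<close>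

lemma periodic_on_circle:
  fixes f :: "real \<Rightarrow> 'a :: topological_space"
  assumes cont: "continuous_on UNIV f" and per: "\<And>w. f (w + 1) = f w"
  obtains g :: "complex \<Rightarrow> 'a" where "continuous_on (sphere 0 1) g" "\<And>w. g (cis (2 * pi * w)) = f w"
proof
  have eq: "f (a / (2 * pi)) = f (b / (2 * pi))" if ab: "cis a = cis b" for a b
  proof -
    from ab obtain n :: int where "\<i> * of_real a = \<i> * of_real b + of_int (2 * n) * of_real pi * \<i>"
      by (auto simp: cis_conv_exp exp_eq)
    then have "\<i> * (of_real a :: complex) = \<i> * of_real (b + 2 * of_int n * pi)"
      by (simp add: algebra_simps)
    then have "complex_of_real a = of_real (b + 2 * of_int n * pi)"
      by (metis complex_i_not_zero mult_left_cancel)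
    then have "a = b + 2 * of_int n * pi" by (simp only: of_real_eq_iff)
    then have "a / (2 * pi) = b / (2 * pi) + of_int n" by (simp add: field_simps)
    then show ?thesis using periodic_int[of f, OF per] by simp
  qed
  let ?g = "\<lambda>z. f (Arg z / (2 * pi))"
  have Arg: "cis (Arg z) = z" "cis (Arg2pi z) = z" if "norm z = 1" for z
  proof -
    have "z \<noteq> 0" using that by auto
    then show "cis (Arg z) = z" using that Arg_eq[of z] by (simp add: cis_conv_exp)
    show "cis (Arg2pi z) = z" using that complex_norm_eq_1_exp[of z] by (simp add: cis_conv_exp)
  qed
  show "?g (cis (2 * pi * w)) = f w" for w
    using eq[of "Arg (cis (2 * pi * w))" "2 * pi * w"] Arg[of "cis (2 * pi * w)"] by simp
  show "continuous_on (sphere 0 1) ?g"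
    unfolding continuous_on_eq_continuous_within
  proof
    fix z :: complex assume z: "z \<in> sphere 0 1"
    have contf: "isCont f x" for x using cont by (simp add: continuous_on_eq_continuous_at)
    show "continuous (at z within sphere 0 1) ?g"
    proof (cases "z \<in> \<real>\<^sub>\<le>\<^sub>0")
      case False
      then have "isCont ?g z" 
        by (intro isCont_o2[OF _ contf] continuous_intros continuous_at_Arg) auto
      then show ?thesis by (rule continuous_at_imp_continuous_at_within)
    next
      case True
      moreover have "z \<noteq> 0" using z by auto
      ultimately have "z \<notin> \<real>\<^sub>\<ge>\<^sub>0" by (auto simp: complex_nonpos_Reals_iff complex_nonneg_Reals_iff complex_eq_iff)
      then have "isCont (\<lambda>z. f (Arg2pi z / (2 * pi))) z"
        by (intro isCont_o2[OF _ contf] continuous_intros continuous_at_Arg2pi) auto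
      then have "continuous (at z within sphere 0 1) (\<lambda>z. f (Arg2pi z / (2 * pi)))"
        by (rule continuous_at_imp_continuous_at_within)
      then show ?thesis
        by (rule continuous_transform_within[OF _ zero_less_one z]) (auto intro!: eq simp: Arg)
    qed
  qed
qed

definition no_fourier_coeffs :: "(real \<Rightarrow> complex) \<Rightarrow> bool" where
  "no_fourier_coeffs f \<longleftrightarrow> continuous_on UNIV f \<and> (\<forall>k. ((\<lambda>w. f w * circle_char k w) has_integral 0) {0..1})"

lemma no_fourier_coeffs_add:
  "no_fourier_coeffs f \<Longrightarrow> no_fourier_coeffs g \<Longrightarrow> no_fourier_coeffs (\<lambda>w. f w + g w)"
  unfolding no_fourier_coeffs_def
  using has_integral_add[of "\<lambda>w. f w * circle_char k w" 0 "{0..1}" "\<lambda>w. g w * circle_char k w" 0 for k]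
  by (auto intro!: continuous_intros simp: distrib_right)

lemma no_fourier_coeffs_cmult: "no_fourier_coeffs f \<Longrightarrow> no_fourier_coeffs (\<lambda>w. c * f w)"
  unfolding no_fourier_coeffs_def
  using has_integral_mult_right[of "\<lambda>w. f w * circle_char k w" 0 "{0..1}" c for k]
  by (auto intro!: continuous_intros simp: mult.assoc)

lemma no_fourier_coeffs_circle_char: "no_fourier_coeffs f \<Longrightarrow> no_fourier_coeffs (\<lambda>w. circle_char j w * f w)"
proof -
  assume f: "no_fourier_coeffs f"
  have "(\<lambda>w. circle_char j w * f w * circle_char k w) = (\<lambda>w. f w * circle_char (j + k) w)" for k
    by (simp add: circle_char_mult[symmetric] mult_ac)
  with f show ?thesis
    unfolding no_fourier_coeffs_def by (auto intro!: continuous_intros)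
qed

lemma Re_Im_cis_circle_char:
  "complex_of_real (Re (cis (2 * pi * w))) = 1 / 2 * (circle_char 1 w + circle_char (-1) w)"
  "complex_of_real (Im (cis (2 * pi * w))) = - \<i> / 2 * (circle_char 1 w + (-1) * circle_char (-1) w)"
proof -
  have "circle_char 1 w = cis (2 * pi * w)" "circle_char (-1) w = cis (- (2 * pi * w))"
    by (simp_all add: circle_char_def cis_conv_exp mult_ac)
  then show "complex_of_real (Re (cis (2 * pi * w))) = 1 / 2 * (circle_char 1 w + circle_char (-1) w)"
    "complex_of_real (Im (cis (2 * pi * w))) = - \<i> / 2 * (circle_char 1 w + (-1) * circle_char (-1) w)"
    by (simp_all add: complex_eq_iff)
qed

text \<open>Multiplying by a character only shifts the Fourier coefficients, hence preserves their
  vanishing. The coordinate functions on the circle are combinations of two characters, and the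
  functions whose multiplication preserves this vanishing are closed under sums and products.\<close>

lemma no_fourier_coeffs_polynomial:
  assumes "real_polynomial_function g" "no_fourier_coeffs f"
  shows "no_fourier_coeffs (\<lambda>w. of_real (g (cis (2 * pi * w))) * f w)"
  using assms
proof (induction arbitrary: f rule: real_polynomial_function.induct)
  case (linear g)
  have g: "g z = Re z * g 1 + Im z * g \<i>" for z
  proof -
    have "g z = g (Re z *\<^sub>R 1 + Im z *\<^sub>R \<i>)" by (intro arg_cong[of _ _ g]) (simp add: complex_eq_iff)
    also have "\<dots> = Re z * g 1 + Im z * g \<i>"
      using linear(1) by (simp only: linear_simps real_scaleR_def)
    finally show ?thesis .
  qed
  have "of_real (g (cis (2 * pi * w))) * f w =
          (of_real (g 1) * (1 / 2)) * (circle_char 1 w * f w + circle_char (-1) w * f w) +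
          (of_real (g \<i>) * (- \<i> / 2)) * (circle_char 1 w * f w + (-1) * (circle_char (-1) w * f w))" for w
    unfolding g[of "cis (2 * pi * w)"] of_real_add of_real_mult Re_Im_cis_circle_char by (simp add: algebra_simps)
  then show ?case
    by (simp only:) (intro no_fourier_coeffs_add no_fourier_coeffs_cmult no_fourier_coeffs_circle_char linear.prems)
next
  case (const c)
  then show ?case by (intro no_fourier_coeffs_cmult)
next
  case (add g h)
  then show ?case using no_fourier_coeffs_add[OF add.IH(1)[of f] add.IH(2)[of f]] by (simp add: distrib_right)
next
  case (mult g h)
  then show ?case using mult.IH(1)[OF mult.IH(2)[OF mult.prems]] by (simp add: mult.assoc)
qed

text \<open>The real part is orthogonal to all polynomials on the circle and, by the Stone--Weierstrass
  theorem, a uniform limit of such; hence it is orthogonal to itself.\<close>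

lemma no_fourier_coeffs_Re_eq_0:
  assumes f: "no_fourier_coeffs f" and per: "\<And>w. f (w + 1) = f w"
  shows "Re (f w) = 0"
proof -
  define r where "r w = Re (f w)" for w
  have contf: "continuous_on UNIV f" using f by (simp add: no_fourier_coeffs_def)
  have contr: "continuous_on UNIV r" unfolding r_def by (intro continuous_intros contf)
  obtain g where g: "continuous_on (sphere 0 1) g" "\<And>w. g (cis (2 * pi * w)) = r w"
    using periodic_on_circle[OF contr] per by (auto simp: r_def)
  have orth: "((\<lambda>w. r w * p (cis (2 * pi * w))) has_integral 0) {0..1}" if "real_polynomial_function p" for p
  proof -
    have "((\<lambda>w. of_real (p (cis (2 * pi * w))) * f w * circle_char 0 w) has_integral 0) {0..1}"
      using no_fourier_coeffs_polynomial[OF that f] unfolding no_fourier_coeffs_def by blast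
    from has_integral_Re[OF this] show ?thesis by (simp add: r_def mult.commute)
  qed
  obtain M where M: "\<And>w. w \<in> {0..1} \<Longrightarrow> \<bar>r w\<bar> \<le> M" "0 < M"
  proof -
    have "bounded (r ` {0..1})"
      by (intro compact_imp_bounded compact_continuous_image continuous_on_subset[OF contr]) auto
    then obtain b where "0 < b" "\<And>w. w \<in> {0..1} \<Longrightarrow> \<bar>r w\<bar> \<le> b" unfolding bounded_pos by auto
    with that show ?thesis by blast
  qed
  have sq: "(\<lambda>w. r w * r w) integrable_on {0..1}"
    by (intro integrable_continuous_interval continuous_intros continuous_on_subset[OF contr]) auto
  have le_M: "integral {0..1} (\<lambda>w. r w * r w) \<le> M * \<epsilon>" if "0 < \<epsilon>" for \<epsilon>
  proof -
    obtain p where p: "real_polynomial_function p" "\<And>z. z \<in> sphere 0 1 \<Longrightarrow> \<bar>g z - p z\<bar> < \<epsilon>"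
      using Stone_Weierstrass_real_polynomial_function[OF compact_sphere g(1) \<open>0 < \<epsilon>\<close>] by blast
    have lhs: "((\<lambda>w. r w * r w - r w * p (cis (2 * pi * w))) has_integral (integral {0..1} (\<lambda>w. r w * r w) - 0)) {0..1}"
      by (intro has_integral_diff integrable_integral sq orth p)
    have rhs: "((\<lambda>w. M * \<epsilon>) has_integral M * \<epsilon>) {0..1::real}"
      using has_integral_const_real[of "M * \<epsilon>" 0 1] by simp
    have "r w * r w - r w * p (cis (2 * pi * w)) \<le> M * \<epsilon>" if "w \<in> {0..1}" for w
    proof -
      have "\<bar>r w * (r w - p (cis (2 * pi * w)))\<bar> \<le> M * \<epsilon>"
        unfolding abs_mult using M(1)[OF that] p(2)[of "cis (2 * pi * w)"] g(2)[of w] M(2)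
        by (intro mult_mono) auto
      then show ?thesis by (simp add: right_diff_distrib)
    qed
    from has_integral_le[OF lhs rhs this] show ?thesis by simp
  qed
  then have "integral {0..1} (\<lambda>w. r w * r w) \<le> 0 + \<epsilon>" if "0 < \<epsilon>" for \<epsilon>
    using le_M[of "\<epsilon> / M"] that M(2) by simp
  then have "integral {0..1} (\<lambda>w. r w * r w) \<le> 0"
    by (rule field_le_epsilon)
  moreover have "integral {0..1} (\<lambda>w. r w * r w) \<ge> 0" by (intro integral_nonneg sq) auto
  ultimately have "integral {0..1} (\<lambda>w. r w * r w) = 0" by simp
  then have zero: "((\<lambda>w. r w * r w) has_integral 0) (cbox 0 1)"
    using sq by (metis integrable_integral interval_cbox)
  have 01: "r w * r w = 0" if "w \<in> {0..1}" for w
    using has_integral_0_cbox_imp_0[OF _ _ zero, of w] that contr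
    by (auto intro!: continuous_intros intro: continuous_on_subset)
  have "r w = r (frac w + of_int \<lfloor>w\<rfloor>)" by (simp add: frac_def)
  also have "\<dots> = r (frac w)" by (intro periodic_int) (simp add: r_def per)
  also have "\<dots> = 0" using 01[of "frac w"] frac_ge_0[of w] frac_lt_1[of w] by (auto simp: less_imp_le)
  finally show ?thesis by (simp add: r_def)
qed

lemma no_fourier_coeffs_eq_0:
  assumes f: "no_fourier_coeffs f" and per: "\<And>w. f (w + 1) = f w"
  shows "f w = 0"
proof -
  have "Re (f w) = 0" using f per by (rule no_fourier_coeffs_Re_eq_0)
  moreover have "Re (\<i> * f w) = 0"
    by (rule no_fourier_coeffs_Re_eq_0[OF no_fourier_coeffs_cmult[OF f]]) (simp add: per)
  ultimately show ?thesis by (simp add: complex_eq_iff)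
qed

lemma uniform_limit_fourier_series:
  assumes "(\<lambda>j. norm (c j)) summable_on UNIV"
  shows "uniform_limit A (\<lambda>X w. \<Sum>j\<in>X. c j * circle_char (- j) w * circle_char k w)
           (\<lambda>w. (\<Sum>\<^sub>\<infinity>j. c j * circle_char (- j) w) * circle_char k w) (finite_subsets_at_top UNIV)"
proof -
  have "uniform_limit A (\<lambda>X w. \<Sum>j\<in>X. c j * circle_char (- j) w * circle_char k w)
           (\<lambda>w. \<Sum>\<^sub>\<infinity>j. c j * circle_char (- j) w * circle_char k w) (finite_subsets_at_top UNIV)"
    by (rule Weierstrass_m_test_general[OF _ assms]) (simp add: norm_mult)
  then show ?thesis by (simp add: infsum_cmult_left')
qed

text \<open>Both \<open>f\<close> and the sum of its Fourier series are continuous and have the same coefficients.\<close>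

lemma fourier_inversion:
  assumes cont: "continuous_on UNIV f" and per: "\<And>w. f (w + 1) = f w"
    and coeff: "\<And>k. ((\<lambda>w. f w * circle_char k w) has_integral c k) {0..1}"
    and summable: "(\<lambda>k. norm (c k)) summable_on UNIV"
  shows "((\<lambda>k. c k * circle_char (- k) w) has_sum f w) UNIV"
proof -
  define S where "S w = (\<Sum>\<^sub>\<infinity>j. c j * circle_char (- j) w)" for w
  have contS: "continuous_on UNIV S"
  proof -
    have "continuous_on UNIV (\<lambda>w. S w * circle_char 0 w)"
      unfolding S_def
      by (rule uniform_limit_theorem[OF _ uniform_limit_fourier_series[OF summable]])
         (auto intro!: always_eventually continuous_intros)
    then show ?thesis by simp
  qed
  have coeffS: "((\<lambda>w. S w * circle_char k w) has_integral c k) {0..1}" for k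
  proof -
    have "continuous_on {0..1} (\<lambda>w. \<Sum>j\<in>X. c j * circle_char (- j) w * circle_char k w)" for X
      by (intro continuous_intros)
    then obtain I J where IJ: "\<And>X. ((\<lambda>w. \<Sum>j\<in>X. c j * circle_char (- j) w * circle_char k w) has_integral I X) {0..1}"
        "((\<lambda>w. S w * circle_char k w) has_integral J) {0..1}" "(I \<longlongrightarrow> J) (finite_subsets_at_top UNIV)"
      by (rule uniform_limit_integral[OF uniform_limit_fourier_series[OF summable, folded S_def] _ finite_subsets_at_top_neq_bot]) (rule that)
    have I: "I X = (\<Sum>j\<in>X. c j * of_bool (j = k))" if "finite X" for X
    proof (rule has_integral_unique[OF IJ(1)])
      have "((\<lambda>w. c j * circle_char (k - j) w) has_integral c j * of_bool (j = k)) {0..1}" for j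
      proof -
        have "k - j = 0 \<longleftrightarrow> j = k" by auto
        then show ?thesis
          using has_integral_mult_right[OF has_integral_circle_char[of "k - j"], of "c j"] by (simp only:)
      qed
      then have "((\<lambda>w. \<Sum>j\<in>X. c j * circle_char (k - j) w) has_integral (\<Sum>j\<in>X. c j * of_bool (j = k))) {0..1}"
        using that by (intro has_integral_sum)
      then show "((\<lambda>w. \<Sum>j\<in>X. c j * circle_char (- j) w * circle_char k w) has_integral (\<Sum>j\<in>X. c j * of_bool (j = k))) {0..1}"
        by (simp add: mult.assoc circle_char_mult)
    qed
    \<comment> \<open>Uniform convergence allows integration term by term, and by orthogonality the \<open>k\<close>-th coefficient
      of a partial sum is \<open>c k\<close> as soon as the sum contains that term.\<close>
    have "eventually (\<lambda>X. I X = c k) (finite_subsets_at_top UNIV)"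
      unfolding eventually_finite_subsets_at_top
      by (rule exI[of _ "{k}"]) (auto simp: I of_bool_def if_distrib cong: if_cong)
    then have "(I \<longlongrightarrow> c k) (finite_subsets_at_top UNIV)" by (rule tendsto_eventually)
    then have "J = c k" using IJ(3) by (rule tendsto_unique[OF finite_subsets_at_top_neq_bot, rotated])
    then show ?thesis using IJ(2) by simp
  qed
  have "no_fourier_coeffs (\<lambda>w. f w - S w)"
    unfolding no_fourier_coeffs_def
  proof (intro conjI allI)
    show "continuous_on UNIV (\<lambda>w. f w - S w)" by (intro continuous_intros cont contS)
    show "((\<lambda>w. (f w - S w) * circle_char k w) has_integral 0) {0..1}" for k
      using has_integral_diff[OF coeff coeffS, of k k] by (simp add: left_diff_distrib)
  qed
  moreover have "f (w + 1) - S (w + 1) = f w - S w" for w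
    using circle_char_add_int[of _ w 1] by (simp add: per S_def)
  ultimately have "f w - S w = 0" by (rule no_fourier_coeffs_eq_0)
  moreover have "(\<lambda>k. c k * circle_char (- k) w) summable_on UNIV"
    by (rule abs_summable_summable) (use summable in \<open>simp add: norm_mult\<close>)
  ultimately show ?thesis by (simp add: S_def has_sum_infsum)
qed

section \<open>A Mellin transform on the imaginary axis\<close>

text \<open>Subtracting the indicator of the unit interval removes the pole of \<open>Gamma\<close> at 0: the Mellin
  transform of this function converges for \<open>Re s > -1\<close>, in particular on the imaginary axis.\<close>

definition cut_exp :: "real \<Rightarrow> real" where
  "cut_exp u = exp (- u) - of_bool (u \<le> 1)"

lemma norm_of_real_powr: "0 < u \<Longrightarrow> norm (complex_of_real u powr s) = u powr Re s"
  by (simp add: norm_powr_real_powr)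

text \<open>An integrable bound that is uniform in the strip \<open>0 \<le> Re s \<le> 1\<close>. The factor 3 exceeds \<open>exp 1\<close>,
  which makes \<open>3 * exp (- u)\<close> at least 1 on the unit interval.\<close>

lemma cut_exp_powr_bound:
  assumes "0 \<le> u" "0 \<le> Re s" "Re s \<le> 1"
  shows "norm (of_real (cut_exp u) * of_real u powr (s - 1)) \<le> 3 * exp (- u)"
proof (cases "u = 0")
  case True
  then show ?thesis by (simp add: cut_exp_def)
next
  case False
  with assms have u: "0 < u" by simp
  have eq: "norm (of_real (cut_exp u) * of_real u powr (s - 1)) = \<bar>cut_exp u\<bar> * u powr (Re s - 1)"
    using norm_of_real_powr[OF u, of "s - 1"] by (simp add: norm_mult)
  show ?thesis
  proof (cases "u \<le> 1")
    case True
    have "\<bar>cut_exp u\<bar> \<le> u" using u True exp_ge_add_one_self[of "- u"] by (simp add: cut_exp_def)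
    then have "\<bar>cut_exp u\<bar> * u powr (Re s - 1) \<le> u * u powr (Re s - 1)" by (rule mult_right_mono) simp
    also have "\<dots> = u powr (1 + (Re s - 1))" using u by (subst powr_add) simp
    also have "\<dots> \<le> 1" using u True assms by (simp add: powr_le1)
    also have "1 \<le> 3 * exp (- u)"
    proof -
      have "exp u \<le> exp 1" using True by simp
      also have "\<dots> \<le> 3" using exp_le by simp
      finally show ?thesis by (simp add: exp_minus field_simps)
    qed
    finally show ?thesis using eq by simp
  next
    case False
    then have "u powr (Re s - 1) \<le> u powr 0" using assms by (intro powr_mono) auto
    then have "exp (- u) * u powr (Re s - 1) \<le> exp (- u) * 1" using u by (intro mult_left_mono) auto
    also have "\<dots> \<le> 3 * exp (- u)" by simp
    finally show ?thesis using eq False by (simp add: cut_exp_def)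
  qed
qed

lemma has_integral_powr_complex_01:
  assumes "0 < Re s"
  shows "((\<lambda>u. complex_of_real u powr (s - 1)) has_integral 1 / s) {0..1}"
proof -
  have s: "s \<noteq> 0" using assms by auto
  have "((\<lambda>u. complex_of_real u powr (s - 1)) has_integral
          (of_real 1 powr s / s - of_real 0 powr s / s)) {0..1}"
  proof (rule fundamental_theorem_of_calculus_interior)
    show "continuous_on {0..1} (\<lambda>u. complex_of_real u powr s / s)"
      using assms s by (intro continuous_intros) auto
    fix u :: real assume "u \<in> {0<..<1}"
    then have "((\<lambda>z. z powr s / s) has_field_derivative of_real u powr (s - 1)) (at (of_real u))"
      using s by (auto intro!: derivative_eq_intros simp: complex_nonpos_Reals_iff)
    then show "((\<lambda>u. complex_of_real u powr s / s) has_vector_derivative of_real u powr (s - 1)) (at u)"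
      by (rule has_vector_derivative_real_field)
  qed simp
  then show ?thesis using assms by simp
qed

lemma Mellin_cut_exp:
  assumes "0 < Re s"
  shows "((\<lambda>u. of_real (cut_exp u) * of_real u powr (s - 1)) has_integral (Gamma s - 1 / s)) {0..}"
proof -
  have "((\<lambda>u. if u \<in> {0..1} then complex_of_real u powr (s - 1) else 0) has_integral 1 / s) {0..}"
    using has_integral_powr_complex_01[OF assms] by (subst has_integral_restrict) auto
  then have "((\<lambda>u. of_real u powr (s - 1) / of_real (exp u) -
      (if u \<in> {0..1} then complex_of_real u powr (s - 1) else 0)) has_integral (Gamma s - 1 / s)) {0..}"
    by (intro has_integral_diff Gamma_integral_complex assms)
  then show ?thesis
    by (rule has_integral_eq[rotated]) (auto simp: cut_exp_def exp_minus field_simps exp_of_real)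
qed

text \<open>The continuous extension of \<open>Gamma s - 1 / s\<close> to \<open>s = 0\<close>.\<close>

definition Mellin_limit :: "complex \<Rightarrow> complex" where
  "Mellin_limit s = (if s = 0 then - euler_mascheroni else Gamma s - 1 / s)"

text \<open>At \<open>s = 0\<close> the functional equation turns \<open>Gamma z - 1 / z\<close> into the difference quotient of
  \<open>Gamma\<close> at 1, and \<open>Gamma\<close> has the derivative \<open>- euler_mascheroni\<close> there.\<close>

lemma Mellin_limit_tendsto:
  assumes "Re s = 0"
  shows "(\<lambda>n. Gamma (s + of_real (1 / real (Suc n))) - 1 / (s + of_real (1 / real (Suc n)))) \<longlonglongrightarrow> Mellin_limit s"
proof -
  have lim: "(\<lambda>n. complex_of_real (1 / real (Suc n))) \<longlonglongrightarrow> of_real 0"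
    using LIMSEQ_inverse_real_of_nat unfolding inverse_eq_divide by (rule tendsto_of_real)
  show ?thesis
  proof (cases "s = 0")
    case True
    have "(Gamma has_field_derivative Gamma 1 * Digamma 1) (at (1 :: complex))"
      by (rule has_field_derivative_Gamma) (metis nonpos_Ints_cases of_int_1 of_int_eq_iff not_one_le_zero)
    then have "(\<lambda>h. (Gamma (1 + h) - Gamma 1) / h) \<midarrow>0\<rightarrow> (- euler_mascheroni :: complex)"
      by (simp add: DERIV_def)
    moreover have "filterlim (\<lambda>n. complex_of_real (1 / real (Suc n))) (at 0) sequentially"
      using lim by (auto simp: filterlim_at simp del: of_nat_Suc)
    ultimately have "(\<lambda>n. (Gamma (1 + complex_of_real (1 / real (Suc n))) - Gamma 1) / of_real (1 / real (Suc n)))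
                       \<longlonglongrightarrow> - euler_mascheroni"
      by (rule filterlim_compose)
    moreover have "(Gamma (1 + z) - Gamma 1) / z = Gamma z - 1 / z"
      if "z = complex_of_real (1 / real (Suc n))" for z n
    proof -
      have "0 < Re z" unfolding that by simp
      then have "z \<noteq> 0" "z \<notin> \<int>\<^sub>\<le>\<^sub>0" by (auto elim!: nonpos_Ints_cases)
      then have "Gamma (1 + z) = z * Gamma z" using Gamma_plus1[of z] by (simp add: add.commute)
      then show ?thesis using \<open>z \<noteq> 0\<close> by (simp add: diff_divide_distrib)
    qed
    ultimately show ?thesis using True by (simp add: Mellin_limit_def)
  next
    case False
    then have "Im s \<noteq> 0" using assms by (simp add: complex_eq_iff)
    then have "s \<notin> \<int>\<^sub>\<le>\<^sub>0" by (auto elim!: nonpos_Ints_cases)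
    have "(\<lambda>n. s + complex_of_real (1 / real (Suc n))) \<longlonglongrightarrow> s + of_real 0"
      by (intro tendsto_add tendsto_const lim)
    then have s: "(\<lambda>n. s + complex_of_real (1 / real (Suc n))) \<longlonglongrightarrow> s" by simp
    have "(\<lambda>n. Gamma (s + of_real (1 / real (Suc n))) - 1 / (s + of_real (1 / real (Suc n)))) \<longlonglongrightarrow> Gamma s - 1 / s"
      using False \<open>s \<notin> \<int>\<^sub>\<le>\<^sub>0\<close> by (intro tendsto_diff tendsto_divide tendsto_const tendsto_Gamma s) auto
    then show ?thesis using False by (simp add: Mellin_limit_def)
  qed
qed

lemma cut_exp_dominating: "(\<lambda>u::real. 3 * exp (- u)) integrable_on {0..}"
  using integrable_on_cmult_left[OF integrable_on_exp_minus_to_infinity[of 1 0], of 3] by simp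

lemma Mellin_cut_exp_imaginary:
  assumes "Re s = 0"
  shows "((\<lambda>u. of_real (cut_exp u) * of_real u powr (s - 1)) has_integral Mellin_limit s) {0..}"
proof -
  define f where "f n u = of_real (cut_exp u) * complex_of_real u powr (s + of_real (1 / real (Suc n)) - 1)" for n u
  define g where "g u = of_real (cut_exp u) * complex_of_real u powr (s - 1)" for u
  \<comment> \<open>The exponents approach the imaginary axis horizontally from the right.\<close>
  have int: "(f n has_integral (Gamma (s + of_real (1 / real (Suc n))) - 1 / (s + of_real (1 / real (Suc n))))) {0..}" for n
    unfolding f_def using assms by (intro Mellin_cut_exp) simp
  have conv: "(\<lambda>n. f n u) \<longlonglongrightarrow> g u" if "u \<in> {0..}" for u
  proof (cases "u = 0")
    case False
    have "(\<lambda>n. of_real (cut_exp u) * complex_of_real u powr (s + of_real (1 / real (Suc n)) - 1))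
            \<longlonglongrightarrow> of_real (cut_exp u) * complex_of_real u powr (s + of_real 0 - 1)"
      using False that
      by (intro tendsto_intros tendsto_of_real LIMSEQ_inverse_real_of_nat[unfolded inverse_eq_divide])
         (auto simp: complex_nonpos_Reals_iff)
    then show ?thesis unfolding f_def g_def by simp
  qed (simp add: f_def g_def)
  have bound: "norm (f n u) \<le> 3 * exp (- u)" if "u \<in> {0..}" for n u
    unfolding f_def using that assms by (intro cut_exp_powr_bound) auto
  have "g integrable_on {0..}" "(\<lambda>n. integral {0..} (f n)) \<longlonglongrightarrow> integral {0..} g"
    using dominated_convergence[of f "{0..}", OF _ cut_exp_dominating bound conv] int by blast+
  moreover have "(\<lambda>n. integral {0..} (f n)) \<longlonglongrightarrow> Mellin_limit s"
    using Mellin_limit_tendsto[OF assms] integral_unique[OF int] by simp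
  ultimately have "(g has_integral Mellin_limit s) {0..}"
    using LIMSEQ_unique integrable_integral by metis
  then show ?thesis by (simp add: g_def[abs_def])
qed

lemma Mellin_cut_exp_truncated:
  assumes "Re s = 0"
  shows "(\<lambda>N. integral {2 powr - real N..2 powr real N} (\<lambda>u. of_real (cut_exp u) * of_real u powr (s - 1)))
           \<longlonglongrightarrow> Mellin_limit s"
proof -
  define g where "g u = of_real (cut_exp u) * complex_of_real u powr (s - 1)" for u
  define I where "I N = {2 powr - real N..2 powr real N}" for N
  have I: "I N \<subseteq> {0..}" for N by (auto simp: I_def intro: order_trans[OF powr_ge_zero])
  have g: "(g has_integral Mellin_limit s) {0..}"
    using Mellin_cut_exp_imaginary[OF assms] by (simp add: g_def[abs_def])
  have int: "g integrable_on I N" for N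
    unfolding I_def
    by (rule integrable_on_subinterval[OF has_integral_integrable[OF g]]) (use I in \<open>auto simp: I_def\<close>)
  define f where "f N u = (if u \<in> I N then g u else 0)" for N u
  have "(f N has_integral integral (I N) g) {0..}" for N
    unfolding f_def using I integrable_integral[OF int] by (subst has_integral_restrict) auto
  then have f: "f N integrable_on {0..}" "integral {0..} (f N) = integral (I N) g" for N
    by (auto simp: integrable_on_def intro: integral_unique)
  have bound: "norm (f N u) \<le> 3 * exp (- u)" if "u \<in> {0..}" for N u
    using cut_exp_powr_bound[of u s] that assms by (auto simp: f_def g_def)
  have conv: "(\<lambda>N. f N u) \<longlonglongrightarrow> g u" if "u \<in> {0..}" for u
  proof (cases "u = 0")
    case True
    have "g 0 = 0" by (simp add: g_def cut_exp_def)
    then have "f N u = g u" for N using True by (simp add: f_def)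
    then show ?thesis by simp
  next
    case False
    with that have u: "0 < u" by simp
    have "eventually (\<lambda>N. f N u = g u) sequentially"
      using eventually_ge_at_top[of "nat \<lceil>\<bar>log 2 u\<bar>\<rceil>"]
    proof eventually_elim
      case (elim N)
      then have "- real N \<le> log 2 u" "log 2 u \<le> real N" by linarith+
      then have "2 powr - real N \<le> 2 powr log 2 u" "2 powr log 2 u \<le> 2 powr real N"
        by (auto intro: powr_mono)
      then show ?case using u by (simp add: f_def I_def)
    qed
    then show ?thesis by (rule tendsto_eventually)
  qed
  have "(\<lambda>N. integral {0..} (f N)) \<longlonglongrightarrow> integral {0..} g"
    by (rule dominated_convergence(2)[OF f(1) cut_exp_dominating bound conv])
  then show ?thesis using f(2) integral_unique[OF g] by (simp add: I_def g_def[abs_def])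
qed

section \<open>The periodic fluctuation\<close>

text \<open>The terms of the two-sided series over all dyadic scales, paired so that one series over \<open>nat\<close>
  suffices: the \<open>j\<close>-th term joins the scale \<open>2^j\<close> with the scale \<open>2^(-j-1)\<close>. Passing from \<open>w\<close> to
  \<open>w + 1\<close> shifts the scales by one.\<close>

definition dyadic_term :: "nat \<Rightarrow> real \<Rightarrow> real" where
  "dyadic_term j w = exp (- (2 powr w * 2 ^ j)) - (1 - exp (- (2 powr w / 2 ^ Suc j)))"

definition dyadic_sum :: "real \<Rightarrow> real" where
  "dyadic_sum w = (\<Sum>j. dyadic_term j w)"

definition fluctuation :: "real \<Rightarrow> real" where
  "fluctuation w = 1 - w - dyadic_sum w"

lemma exp_minus_le_inverse:
  fixes y :: real
  assumes "0 < y"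
  shows "exp (- y) \<le> 1 / y"
proof -
  have "y \<le> exp y" using exp_ge_add_one_self[of y] by linarith
  then show ?thesis using assms by (simp add: exp_minus field_simps)
qed

lemma abs_dyadic_term_le:
  assumes "a \<le> w" "w \<le> b"
  shows "\<bar>dyadic_term j w\<bar> \<le> (2 powr (- a) + 2 powr b) / 2 ^ j"
proof -
  have "exp (- (2 powr w * 2 ^ j)) \<le> 1 / (2 powr w * 2 ^ j)"
    by (intro exp_minus_le_inverse) simp
  also have "\<dots> = 2 powr (- w) / 2 ^ j" by (simp add: powr_minus field_simps)
  also have "\<dots> \<le> 2 powr (- a) / 2 ^ j" using assms by (intro divide_right_mono powr_mono) auto
  finally have 1: "exp (- (2 powr w * 2 ^ j)) \<le> 2 powr (- a) / 2 ^ j" .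
  have "1 - exp (- (2 powr w / 2 ^ Suc j)) \<le> 2 powr w / 2 ^ Suc j"
    by (intro one_minus_exp_bounds) simp
  also have "\<dots> \<le> 2 powr b / 2 ^ j" using assms by (intro frac_le powr_mono power_increasing) auto
  finally have 2: "1 - exp (- (2 powr w / 2 ^ Suc j)) \<le> 2 powr b / 2 ^ j" .
  have "0 \<le> exp (- (2 powr w * 2 ^ j))" "0 \<le> 1 - exp (- (2 powr w / 2 ^ Suc j))" by auto
  with 1 2 show ?thesis unfolding dyadic_term_def add_divide_distrib by linarith
qed

lemma dyadic_term_sums: "(\<lambda>j. dyadic_term j w) sums dyadic_sum w"
  unfolding dyadic_sum_def
  by (rule summable_sums, rule summable_comparison_test'[OF summable_div_power_2, of 0])
     (use abs_dyadic_term_le[of w w w] in auto)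

lemma uniform_limit_dyadic_sum_circle_char:
  "uniform_limit {a..b} (\<lambda>N w. \<Sum>j<N. of_real (dyadic_term j w) * circle_char k w)
     (\<lambda>w. of_real (dyadic_sum w) * circle_char k w) sequentially"
proof -
  have "uniform_limit {a..b} (\<lambda>N w. \<Sum>j<N. of_real (dyadic_term j w) * circle_char k w)
     (\<lambda>w. \<Sum>j. of_real (dyadic_term j w) * circle_char k w) sequentially"
    by (rule Weierstrass_m_test[OF _ summable_div_power_2[of "2 powr (- a) + 2 powr b"]])
       (use abs_dyadic_term_le[of a _ b] in \<open>auto simp: norm_mult\<close>)
  moreover have "(\<Sum>j. of_real (dyadic_term j w) * circle_char k w) = of_real (dyadic_sum w) * circle_char k w" for w
    by (rule sums_unique[symmetric]) (intro sums_mult2 sums_of_real dyadic_term_sums)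
  ultimately show ?thesis by simp
qed

lemma continuous_on_dyadic_term: "continuous_on A (dyadic_term j)"
  unfolding dyadic_term_def by (intro continuous_intros) auto

lemma continuous_on_fluctuation: "continuous_on UNIV fluctuation"
proof -
  have "continuous_on {a..b} (\<lambda>w. complex_of_real (dyadic_sum w) * circle_char 0 w)" for a b
    by (rule uniform_limit_theorem[OF _ uniform_limit_dyadic_sum_circle_char])
       (auto intro!: always_eventually continuous_intros continuous_on_dyadic_term)
  then have "continuous_on {a..b} (\<lambda>w. Re (complex_of_real (dyadic_sum w)))" for a b
    by (intro continuous_on_Re) simp
  then have cont: "continuous_on {a..b} dyadic_sum" for a b by simp
  have "isCont dyadic_sum w" for w
    using continuous_on_interior[OF cont[of "w - 1" "w + 1"], of w] by simp
  then have "continuous_on UNIV dyadic_sum" by (simp add: continuous_on_eq_continuous_at)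
  then show ?thesis unfolding fluctuation_def by (intro continuous_intros)
qed

text \<open>The two telescoping series sum to \<open>exp (- x)\<close> and \<open>1 - exp (- x)\<close> for \<open>x = 2 powr w\<close>. This one
  identity yields both the periodicity of the fluctuation and its relation to \<open>doubling_sum\<close>.\<close>

lemma dyadic_telescope:
  fixes w :: real
  shows "(\<lambda>j. exp (- (2 powr w * 2 ^ j)) - exp (- (2 powr w * 2 ^ Suc j)) +
        (exp (- (2 powr w / 2 ^ Suc j)) - exp (- (2 powr w / 2 ^ j)))) sums 1"
proof -
  have lim: "(\<lambda>j. x / 2 ^ j :: real) \<longlonglongrightarrow> 0" for x
    by (rule summable_LIMSEQ_zero[OF summable_div_power_2])
  have "(\<lambda>j. exp (- (2 powr w * 2 ^ j))) \<longlonglongrightarrow> 0"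
  proof (rule tendsto_sandwich[OF _ _ tendsto_const lim[of "1 / 2 powr w"]])
    show "eventually (\<lambda>j. exp (- (2 powr w * 2 ^ j)) \<le> 1 / 2 powr w / 2 ^ j) sequentially"
      using exp_minus_le_inverse[of "2 powr w * 2 ^ j" for j] by (intro always_eventually allI) auto
  qed auto
  from telescope_sums'[OF this]
  have 1: "(\<lambda>j. exp (- (2 powr w * 2 ^ j)) - exp (- (2 powr w * 2 ^ Suc j))) sums (exp (- (2 powr w * 2 ^ 0)) - 0)" .
  have "(\<lambda>j. exp (- (2 powr w / 2 ^ j))) \<longlonglongrightarrow> exp (- 0)"
    by (intro tendsto_intros lim)
  from telescope_sums[OF this]
  have 2: "(\<lambda>j. exp (- (2 powr w / 2 ^ Suc j)) - exp (- (2 powr w / 2 ^ j))) sums (exp (- 0) - exp (- (2 powr w / 2 ^ 0)))" .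
  show ?thesis using sums_add[OF 1 2] by simp
qed

lemma fluctuation_periodic: "fluctuation (w + 1) = fluctuation w"
proof -
  have "(\<lambda>j. dyadic_term j w - dyadic_term j (w + 1)) sums (dyadic_sum w - dyadic_sum (w + 1))"
    by (intro sums_diff dyadic_term_sums)
  moreover have "dyadic_term j w - dyadic_term j (w + 1) =
      exp (- (2 powr w * 2 ^ j)) - exp (- (2 powr w * 2 ^ Suc j)) +
        (exp (- (2 powr w / 2 ^ Suc j)) - exp (- (2 powr w / 2 ^ j)))" for j
    by (simp add: dyadic_term_def powr_add mult.assoc)
  ultimately have "dyadic_sum w - dyadic_sum (w + 1) = 1"
    using sums_unique2[OF _ dyadic_telescope[of w]] by simp
  then show ?thesis by (simp add: fluctuation_def)
qed

text \<open>By \<open>dyadic_telescope\<close> the difference is the sum of \<open>exp (- x * 2^j)\<close> over \<open>j \<ge> 1\<close> at \<open>x = 2 powr w\<close>,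
  which the estimate \<open>exp (- y) \<le> 1 / y\<close> bounds by a geometric series.\<close>

lemma doubling_sum_fluctuation:
  "\<bar>doubling_sum (2 powr w) - w - fluctuation w\<bar> \<le> 1 / 2 powr w"
proof -
  have "(\<lambda>j. (1 - exp (- (2 powr w / 2 ^ j))) + dyadic_term j w) sums (doubling_sum (2 powr w) + dyadic_sum w)"
    unfolding doubling_sum_def by (intro sums_add dyadic_term_sums summable_sums summable_doubling_sum) simp
  from sums_diff[OF this dyadic_telescope[of w]]
  have sums: "(\<lambda>j. exp (- (2 powr w * 2 ^ Suc j))) sums (doubling_sum (2 powr w) + dyadic_sum w - 1)"
    by (simp add: dyadic_term_def)
  have geo: "(\<lambda>j. 1 / 2 powr w * (1 / 2) ^ Suc j) sums (1 / 2 powr w * 1)"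
    by (intro sums_mult power_half_series)
  have "exp (- (2 powr w * 2 ^ Suc j)) \<le> 1 / 2 powr w * (1 / 2) ^ Suc j" for j
    using exp_minus_le_inverse[of "2 powr w * 2 ^ Suc j"] by (simp add: power_divide)
  then have "doubling_sum (2 powr w) + dyadic_sum w - 1 \<le> 1 / 2 powr w * 1"
    by (rule sums_le[OF _ sums geo])
  moreover have "0 \<le> doubling_sum (2 powr w) + dyadic_sum w - 1"
    by (rule sums_le[OF _ sums_zero sums]) simp
  ultimately show ?thesis by (simp add: fluctuation_def)
qed

section \<open>Fourier coefficients of the fluctuation\<close>

text \<open>The solutions of \<open>2 powr s = 1\<close>, that is, the frequencies at which \<open>u powr s\<close> is a 1-periodic
  function of \<open>log 2 u\<close>.\<close>

definition chi :: "int \<Rightarrow> complex" where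
  "chi k = 2 * \<i> * of_int k * of_real pi / of_real (ln 2)"

lemma Re_chi [simp]: "Re (chi k) = 0"
proof -
  have "chi k = \<i> * of_real (2 * of_int k * pi / ln 2)" by (simp add: chi_def)
  then show ?thesis by (simp only: Re_i_times Im_complex_of_real neg_0_equal_iff_equal)
qed

lemma chi_eq_0_iff [simp]: "chi k = 0 \<longleftrightarrow> k = 0"
  by (simp add: chi_def)

lemma powr_chi: "complex_of_real (2 powr w) powr chi k = circle_char k w"
proof -
  have "complex_of_real (2 powr w) powr chi k = exp (chi k * of_real (w * ln 2))"
    by (simp add: powr_def Ln_of_real)
  also have "chi k * of_real (w * ln 2) = 2 * \<i> * of_int k * of_real pi * of_real w"
    by (simp add: chi_def)
  finally show ?thesis by (simp only: circle_char_def)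
qed

text \<open>The substitution \<open>u = 2 powr (w + a)\<close>, under which \<open>du / u\<close> becomes \<open>ln 2 * dw\<close> and
  \<open>u powr chi k\<close> becomes the \<open>k\<close>-th character.\<close>

lemma dyadic_substitution:
  fixes f :: "real \<Rightarrow> complex"
  assumes "continuous_on {0<..} f"
  shows "integral {2 powr of_int a..2 powr (of_int a + 1)} (\<lambda>u. f u * of_real u powr (chi k - 1)) =
           of_real (ln 2) * integral {0..1} (\<lambda>w. f (2 powr (w + of_int a)) * circle_char k w)"
proof -
  let ?F = "\<lambda>u. f u * of_real u powr (chi k - 1)"
  let ?g = "\<lambda>w :: real. 2 powr (w + of_int a) :: real"
  have pos: "{2 powr of_int a..2 powr (of_int a + 1)} \<subseteq> {0 :: real<..}"
    by (auto intro: less_le_trans[OF powr_gt_zero[of 2 "of_int a", THEN iffD2]])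
  have sub: "((\<lambda>w. (ln 2 * ?g w) *\<^sub>R ?F (?g w)) has_integral integral {?g 0..?g 1} ?F) {0..1}"
  proof (rule has_integral_substitution)
    show "?g ` {0..1} \<subseteq> {2 powr of_int a..2 powr (of_int a + 1)}" by (auto intro!: powr_mono)
    show "continuous_on {2 powr of_int a..2 powr (of_int a + 1)} ?F"
      using pos by (intro continuous_intros continuous_on_subset[OF assms]) auto
    show "(?g has_real_derivative ln 2 * ?g w) (at w within {0..1})" for w
    proof -
      have "((\<lambda>w. exp ((w + of_int a) * ln 2)) has_real_derivative ln 2 * exp ((w + of_int a) * ln 2)) (at w within {0..1})"
        by (auto intro!: derivative_eq_intros)
      then show ?thesis by (simp add: powr_def)
    qed
  qed auto
  have eq: "(ln 2 * ?g w) *\<^sub>R ?F (?g w) = of_real (ln 2) * (f (?g w) * circle_char k w)" for w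
  proof -
    have "of_real (?g w) * complex_of_real (?g w) powr (chi k - 1) = circle_char k w"
      by (subst powr_diff) (simp add: powr_chi)
    then show ?thesis by (simp add: scaleR_conv_of_real mult_ac)
  qed
  have "integral {?g 0..?g 1} ?F = integral {0..1} (\<lambda>w. of_real (ln 2) * (f (?g w) * circle_char k w))"
    using sub unfolding eq by (rule integral_unique[symmetric])
  also have "\<dots> = of_real (ln 2) * integral {0..1} (\<lambda>w. f (?g w) * circle_char k w)" by simp
  finally show ?thesis by (simp add: add.commute)
qed

text \<open>Each further term of the series extends the interval by one dyadic piece at either end: the
  left piece lies in the unit interval, where \<open>cut_exp\<close> is \<open>exp (- u) - 1\<close>, the right one beyond it.\<close>

lemma integral_dyadic_terms:
  "((\<lambda>u. of_real (cut_exp u) * of_real u powr (chi k - 1)) has_integral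
      of_real (ln 2) * (\<Sum>j<N. integral {0..1} (\<lambda>w. of_real (dyadic_term j w) * circle_char k w)))
     {2 powr - real N..2 powr real N}"
proof (induction N)
  case 0
  then show ?case by (simp add: has_integral_refl)
next
  case (Suc N)
  let ?F = "\<lambda>u. of_real (cut_exp u) * complex_of_real u powr (chi k - 1)"
  \<comment> \<open>The parts of the new term that belong to the right and to the left piece.\<close>
  define R where "R w = complex_of_real (exp (- (2 powr w * 2 ^ N)))" for w
  define L where "L w = complex_of_real (exp (- (2 powr w / 2 ^ Suc N)) - 1)" for w
  have cont_powr: "continuous_on {2 powr a..b} (\<lambda>u. complex_of_real u powr (chi k - 1))" for a b :: real
  proof -
    have "0 < u" if "2 powr a \<le> u" for u :: real
      using that powr_gt_zero[of 2 a] by linarith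
    then show ?thesis by (intro continuous_intros) (auto intro: less_imp_le dest: less_imp_neq)
  qed
  have right: "(?F has_integral of_real (ln 2) * integral {0..1} (\<lambda>w. R w * circle_char k w))
      {2 powr real N..2 powr real (Suc N)}"
  proof -
    let ?G = "\<lambda>u. complex_of_real (exp (- u)) * complex_of_real u powr (chi k - 1)"
    have int: "?G integrable_on {2 powr real N..2 powr real (Suc N)}"
      by (intro integrable_continuous_interval continuous_intros cont_powr)
    have "continuous_on {0<..} (\<lambda>u. complex_of_real (exp (- u)))" by (intro continuous_intros)
    from dyadic_substitution[OF this, of "int N" k]
    have "integral {2 powr real N..2 powr real (Suc N)} ?G =
        of_real (ln 2) * integral {0..1} (\<lambda>w. R w * circle_char k w)"
      by (simp add: R_def powr_add powr_realpow add.commute)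
    with integrable_integral[OF int] have "(?G has_integral of_real (ln 2) * integral {0..1} (\<lambda>w. R w * circle_char k w))
      {2 powr real N..2 powr real (Suc N)}" by (simp only:)
    moreover have "?F u = ?G u" if "u \<in> {2 powr real N..2 powr real (Suc N)} - {1}" for u
    proof -
      have "2 powr 0 \<le> 2 powr real N" by (intro powr_mono) auto
      then have "1 < u" using that by auto
      then show ?thesis by (simp add: cut_exp_def)
    qed
    ultimately show ?thesis by (intro has_integral_spike_finite[of "{1}" _ ?F ?G]) auto
  qed
  have left: "(?F has_integral of_real (ln 2) * integral {0..1} (\<lambda>w. L w * circle_char k w))
      {2 powr - real (Suc N)..2 powr - real N}"
  proof -
    let ?G = "\<lambda>u. complex_of_real (exp (- u) - 1) * complex_of_real u powr (chi k - 1)"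
    have int: "?G integrable_on {2 powr - real (Suc N)..2 powr - real N}"
      by (intro integrable_continuous_interval continuous_intros cont_powr)
    have powr_eq: "2 powr (w + of_int (- int (Suc N))) = 2 powr w / 2 ^ Suc N" for w :: real
    proof -
      have "w + of_int (- int (Suc N)) = w - real (Suc N)" by simp
      then show ?thesis by (simp only: powr_diff powr_realpow zero_less_numeral)
    qed
    have "continuous_on {0<..} (\<lambda>u. complex_of_real (exp (- u) - 1))" by (intro continuous_intros)
    from dyadic_substitution[OF this, of "- int (Suc N)" k, unfolded powr_eq]
    have "integral {2 powr - real (Suc N)..2 powr - real N} ?G =
        of_real (ln 2) * integral {0..1} (\<lambda>w. L w * circle_char k w)"
      by (simp add: L_def)
    with integrable_integral[OF int] have "(?G has_integral of_real (ln 2) * integral {0..1} (\<lambda>w. L w * circle_char k w))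
      {2 powr - real (Suc N)..2 powr - real N}" by (simp only:)
    moreover have "?G u = ?F u" if "u \<in> {2 powr - real (Suc N)..2 powr - real N}" for u
    proof -
      have "2 powr - real N \<le> 2 powr 0" by (intro powr_mono) auto
      then have "u \<le> 1" using that by auto
      then show ?thesis by (simp add: cut_exp_def)
    qed
    ultimately show ?thesis by (rule has_integral_eq[rotated])
  qed
  have le: "2 powr - real (Suc N) \<le> 2 powr - real N" "2 powr - real N \<le> 2 powr real N"
    "2 powr real N \<le> 2 powr real (Suc N)" by (auto intro!: powr_mono)
  have cont: "(\<lambda>w. R w * circle_char k w) integrable_on {0..1}" "(\<lambda>w. L w * circle_char k w) integrable_on {0..1}"
    unfolding R_def L_def by (intro integrable_continuous_interval continuous_intros; simp)+
  have "(\<lambda>w. of_real (dyadic_term N w) * circle_char k w) = (\<lambda>w. R w * circle_char k w + L w * circle_char k w)"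
    by (simp add: dyadic_term_def R_def L_def algebra_simps)
  then have sum: "integral {0..1} (\<lambda>w. of_real (dyadic_term N w) * circle_char k w) =
      integral {0..1} (\<lambda>w. R w * circle_char k w) + integral {0..1} (\<lambda>w. L w * circle_char k w)"
    using integral_add[OF cont] by simp
  have "2 powr - real (Suc N) \<le> 2 powr real N" using le by linarith
  from has_integral_combine[OF this le(3) has_integral_combine[OF le(1,2) left Suc.IH] right]
  show ?case by (simp only: sum.lessThan_Suc sum distrib_left add_ac)
qed

lemma has_integral_dyadic_sum_circle_char:
  "((\<lambda>w. of_real (dyadic_sum w) * circle_char k w) has_integral Mellin_limit (chi k) / of_real (ln 2)) {0..1}"
proof -
  have "continuous_on {0..1} (\<lambda>w. \<Sum>j<N. of_real (dyadic_term j w) * circle_char k w)" for N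
    by (intro continuous_intros continuous_on_dyadic_term)
  then obtain I J where IJ: "\<And>N. ((\<lambda>w. \<Sum>j<N. of_real (dyadic_term j w) * circle_char k w) has_integral I N) {0..1}"
      "((\<lambda>w. of_real (dyadic_sum w) * circle_char k w) has_integral J) {0..1}" "I \<longlonglongrightarrow> J"
    by (rule uniform_limit_integral[OF uniform_limit_dyadic_sum_circle_char _ sequentially_bot]) (rule that)
  have "I N = (\<Sum>j<N. integral {0..1} (\<lambda>w. of_real (dyadic_term j w) * circle_char k w))" for N
    by (rule has_integral_unique[OF IJ(1)])
       (intro has_integral_sum integrable_integral integrable_continuous_interval continuous_intros continuous_on_dyadic_term finite_lessThan)
  then have "integral {2 powr - real N..2 powr real N} (\<lambda>u. of_real (cut_exp u) * of_real u powr (chi k - 1))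
      = of_real (ln 2) * I N" for N
    using integral_unique[OF integral_dyadic_terms[of k N]] by simp
  then have "(\<lambda>N. of_real (ln 2) * I N) \<longlonglongrightarrow> Mellin_limit (chi k)"
    using Mellin_cut_exp_truncated[of "chi k"] by simp
  moreover have "(\<lambda>N. of_real (ln 2) * I N) \<longlonglongrightarrow> of_real (ln 2) * J" by (intro tendsto_intros IJ(3))
  ultimately have "Mellin_limit (chi k) = of_real (ln 2) * J" by (rule LIMSEQ_unique)
  then show ?thesis using IJ(2) by simp
qed

definition fluctuation_coeff :: "int \<Rightarrow> complex" where
  "fluctuation_coeff k = (if k = 0 then of_real (euler_mascheroni / ln 2 + 1 / 2) else - Gamma (chi k) / of_real (ln 2))"

lemma has_integral_linear_circle_char:
  "((\<lambda>w. of_real (1 - w) * circle_char k w) has_integral (if k = 0 then 1 / 2 else - 1 / (2 * \<i> * of_int k * of_real pi))) {0..1}"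
proof (cases "k = 0")
  case True
  have "((\<lambda>w::real. 1 - w) has_integral 1 / 2) {0..1}"
    using has_integral_diff[OF has_integral_const_real[of 1 0 1] ident_has_integral[of 0 1]] by simp
  from has_integral_of_real[OF this]
  have "((\<lambda>w. complex_of_real (1 - w)) has_integral of_real (1 / 2)) {0..1}" .
  with True show ?thesis by simp
next
  case False
  define a where "a = 2 * \<i> * of_int k * complex_of_real pi"
  have a: "a \<noteq> 0" using False by (simp add: a_def)
  define G where "G z = (1 - z) * exp (a * z) / a + exp (a * z) / a\<^sup>2" for z
  have "((\<lambda>w. of_real (1 - w) * exp (a * of_real w)) has_integral (G (of_real 1) - G (of_real 0))) {0..1}"
  proof (rule fundamental_theorem_of_calculus)
    fix w :: real
    have "(G has_field_derivative (1 - of_real w) * exp (a * of_real w)) (at (of_real w))"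
      unfolding G_def using a
      by (auto intro!: derivative_eq_intros simp: field_simps power2_eq_square)
    then show "((\<lambda>w. G (of_real w)) has_vector_derivative of_real (1 - w) * exp (a * of_real w)) (at w within {0..1})"
      by (auto intro: has_vector_derivative_real_field has_vector_derivative_at_within)
  qed simp
  moreover have "exp a = 1" using circle_char_add_int[of k 0 1] by (simp add: circle_char_def a_def)
  moreover have "circle_char k = (\<lambda>w. exp (a * of_real w))" by (rule ext) (simp add: circle_char_def a_def)
  ultimately show ?thesis using False by (simp add: G_def flip: a_def)
qed

text \<open>For \<open>k \<noteq> 0\<close> the coefficient \<open>-1 / (2 * \<pi> * i * k)\<close> of the linear function \<open>1 - w\<close> cancels the term
  \<open>1 / s\<close> of the Mellin transform, which leaves the value of \<open>Gamma\<close> alone.\<close>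

lemma has_integral_fluctuation_circle_char:
  "((\<lambda>w. of_real (fluctuation w) * circle_char k w) has_integral fluctuation_coeff k) {0..1}"
proof -
  have "((\<lambda>w. of_real (1 - w) * circle_char k w - of_real (dyadic_sum w) * circle_char k w) has_integral
      (if k = 0 then 1 / 2 else - 1 / (2 * \<i> * of_int k * of_real pi)) - Mellin_limit (chi k) / of_real (ln 2)) {0..1}"
    by (intro has_integral_diff has_integral_linear_circle_char has_integral_dyadic_sum_circle_char)
  moreover have "(if k = 0 then 1 / 2 else - 1 / (2 * \<i> * of_int k * of_real pi)) - Mellin_limit (chi k) / of_real (ln 2)
      = fluctuation_coeff k"
    by (auto simp: Mellin_limit_def fluctuation_coeff_def of_real_euler_mascheroni diff_divide_distrib)
       (simp add: chi_def)
  ultimately show ?thesis by (simp add: fluctuation_def algebra_simps)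
qed

section \<open>The Fourier series of the fluctuation\<close>

text \<open>By the integral formula \<open>Gamma (s + 2)\<close> is at most \<open>Gamma 2 = 1\<close> in absolute value on the
  imaginary axis, and applying the functional equation twice divides it by \<open>s * (s + 1)\<close>,
  whose factors have absolute value at least \<open>\<bar>k\<bar>\<close> at \<open>s = chi k\<close>.\<close>

lemma norm_Gamma_chi_le:
  assumes "k \<noteq> 0"
  shows "norm (Gamma (chi k)) \<le> 1 / (real_of_int k)\<^sup>2"
proof -
  have chi: "chi k = \<i> * of_real (2 * of_int k * pi / ln 2)" by (simp add: chi_def)
  have notint: "chi k \<notin> \<int>\<^sub>\<le>\<^sub>0" "chi k + 1 \<notin> \<int>\<^sub>\<le>\<^sub>0"
    using assms by (auto elim!: nonpos_Ints_cases simp: complex_eq_iff chi)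
  have "norm (Gamma (chi k + 2)) \<le> Gamma 2"
  proof -
    have c: "((\<lambda>t. of_real t powr (chi k + 2 - 1) / of_real (exp t)) has_integral Gamma (chi k + 2)) {0..}"
      by (rule Gamma_integral_complex) simp
    have r: "((\<lambda>t. t powr (2 - 1) / exp t) has_integral Gamma (2 :: real)) {0..}"
      by (rule Gamma_integral_real) simp
    have "norm (integral {0..} (\<lambda>t. complex_of_real t powr (chi k + 2 - 1) / of_real (exp t)))
            \<le> integral {0..} (\<lambda>t :: real. t powr (2 - 1) / exp t)"
    proof (rule integral_norm_bound_integral)
      fix t :: real assume t: "t \<in> {0..}"
      show "norm (complex_of_real t powr (chi k + 2 - 1) / of_real (exp t)) \<le> t powr (2 - 1) / exp t"
      proof (cases "t = 0")
        case False
        with t have "0 < t" by simp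
        then have "norm (complex_of_real t powr (chi k + 2 - 1)) = t powr (2 - 1)"
          using norm_of_real_powr[of t "chi k + 2 - 1"] by simp
        then show ?thesis by (simp add: norm_divide)
      qed simp
    qed (use c r in \<open>auto intro: has_integral_integrable\<close>)
    then show ?thesis using integral_unique[OF c] integral_unique[OF r] by simp
  qed
  also have "Gamma (2 :: real) = 1" using Gamma_fact[of 1, where 'a = real] by simp
  also have "Gamma (chi k + 2) = (chi k + 1) * (chi k * Gamma (chi k))"
    using Gamma_plus1[OF notint(1)] Gamma_plus1[OF notint(2)] by (simp add: add.assoc)
  finally have "norm (chi k + 1) * (norm (chi k) * norm (Gamma (chi k))) \<le> 1" by (simp add: norm_mult)
  moreover have "\<bar>real_of_int k\<bar> \<le> norm (chi k)" "norm (chi k) \<le> norm (chi k + 1)"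
  proof -
    have "ln 2 \<le> (1 :: real)" using ln_le_minus_one[of 2] by simp
    also have "1 \<le> 2 * pi" using pi_gt3 by simp
    finally have "\<bar>real_of_int k\<bar> * ln 2 \<le> \<bar>real_of_int k\<bar> * (2 * pi)" by (intro mult_left_mono) auto
    moreover have "norm (chi k) = \<bar>2 * of_int k * pi / ln 2\<bar>"
      unfolding chi norm_mult norm_of_real by simp
    ultimately have "\<bar>real_of_int k\<bar> * ln 2 \<le> norm (chi k) * ln 2" by (simp add: abs_mult)
    then show "\<bar>real_of_int k\<bar> \<le> norm (chi k)" by (rule mult_right_le_imp_le) simp
    show "norm (chi k) \<le> norm (chi k + 1)"
      by (simp add: cmod_def real_le_rsqrt)
  qed
  then have "\<bar>real_of_int k\<bar> * (\<bar>real_of_int k\<bar> * norm (Gamma (chi k)))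
      \<le> norm (chi k + 1) * (norm (chi k) * norm (Gamma (chi k)))"
    by (intro mult_mono) auto
  ultimately have "\<bar>real_of_int k\<bar> * (\<bar>real_of_int k\<bar> * norm (Gamma (chi k))) \<le> 1" by linarith
  then have "(real_of_int k)\<^sup>2 * norm (Gamma (chi k)) \<le> 1" 
    by (simp add: power2_eq_square abs_mult_self_eq flip: mult.assoc)
  then show ?thesis using assms by (simp add: field_simps)
qed

lemma inverse_squares_summable_on_int: "(\<lambda>k::int. 1 / (real_of_int k)\<^sup>2) summable_on UNIV"
proof -
  have nat: "(\<lambda>n::nat. 1 / (real n)\<^sup>2) summable_on UNIV"
    using inverse_power_summable[of 2, where 'a = real]
    by (subst summable_on_UNIV_nonneg_real_iff) (auto simp: inverse_eq_divide)
  have "(\<lambda>k::int. 1 / (real_of_int k)\<^sup>2) summable_on range int"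
    using nat by (subst summable_on_reindex) (auto simp: o_def)
  moreover have "(\<lambda>k::int. 1 / (real_of_int k)\<^sup>2) summable_on range (\<lambda>n. - int n)"
    using nat by (subst summable_on_reindex) (auto simp: o_def inj_on_def)
  moreover have "UNIV = range int \<union> range (\<lambda>n. - int n)"
    by (auto, metis int_cases2 rangeI)
  ultimately show ?thesis using summable_on_union by metis
qed

lemma fluctuation_coeff_summable: "(\<lambda>k. norm (fluctuation_coeff k)) summable_on UNIV"
proof -
  have "(\<lambda>k. 1 / ln 2 * (1 / (real_of_int k)\<^sup>2)) summable_on - {0}"
    by (intro summable_on_cmult_right summable_on_subset_banach[OF inverse_squares_summable_on_int]) auto
  moreover have "norm (fluctuation_coeff k) \<le> 1 / ln 2 * (1 / (real_of_int k)\<^sup>2)" if "k \<in> - {0}" for k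
  proof -
    have "norm (fluctuation_coeff k) = 1 / ln 2 * norm (Gamma (chi k))"
      using that by (simp add: fluctuation_coeff_def norm_divide)
    also have "\<dots> \<le> 1 / ln 2 * (1 / (real_of_int k)\<^sup>2)"
      using that by (intro mult_left_mono norm_Gamma_chi_le) auto
    finally show ?thesis .
  qed
  ultimately have "(\<lambda>k. norm (fluctuation_coeff k)) summable_on - {0}"
    by (rule summable_on_comparison_test) auto
  then have "(\<lambda>k. norm (fluctuation_coeff k)) summable_on insert 0 (- {0})"
    by (subst summable_on_insert_iff) 
  moreover have "insert 0 (- {0}) = (UNIV :: int set)" by auto
  ultimately show ?thesis by simp
qed

text \<open>The subtracted constant is the mean of the fluctuation over a period.\<close>

definition centred_fluctuation :: "real \<Rightarrow> real" where
  "centred_fluctuation w = fluctuation w - (euler_mascheroni / ln 2 + 1 / 2)"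

lemma centred_fluctuation_fourier:
  "((\<lambda>k::int. - (1 / complex_of_real (ln 2)) *
              (Gamma (2 * \<i> * of_int k * complex_of_real pi / complex_of_real (ln 2)) *
               exp (- (2 * \<i> * of_int k * complex_of_real pi * complex_of_real w))))
            has_sum complex_of_real (centred_fluctuation w)) (UNIV - {0})"
proof -
  have "((\<lambda>k. fluctuation_coeff k * circle_char (- k) w) has_sum of_real (fluctuation w)) UNIV"
    by (rule fourier_inversion)
       (auto intro!: continuous_intros continuous_on_fluctuation has_integral_fluctuation_circle_char
          fluctuation_coeff_summable simp: fluctuation_periodic)
  moreover have "((\<lambda>k. fluctuation_coeff k * circle_char (- k) w) has_sum fluctuation_coeff 0) {0}"
    using has_sum_finite[of "{0::int}" "\<lambda>k. fluctuation_coeff k * circle_char (- k) w"] by simp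
  ultimately have "((\<lambda>k. fluctuation_coeff k * circle_char (- k) w) has_sum (of_real (fluctuation w) - fluctuation_coeff 0)) (UNIV - {0})"
    by (intro has_sum_Diff) auto
  moreover have "of_real (fluctuation w) - fluctuation_coeff 0 = of_real (centred_fluctuation w)"
    by (simp add: fluctuation_coeff_def centred_fluctuation_def)
  ultimately have "((\<lambda>k. fluctuation_coeff k * circle_char (- k) w) has_sum of_real (centred_fluctuation w)) (UNIV - {0})"
    by simp
  then show ?thesis
    by (rule has_sum_cong[THEN iffD1, rotated]) (simp add: fluctuation_coeff_def chi_def circle_char_def)
qed

lemma doubling_sum_asymptotic:
  "(\<lambda>n. doubling_sum (real n / 8)
      - (log 2 (real n) + euler_mascheroni / ln 2 - 5 / 2 + centred_fluctuation (log 2 (real n))))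
     \<in> O(\<lambda>n. 1 / real n)"
proof (rule bigoI)
  have le: "\<bar>doubling_sum (real n / 8)
      - (log 2 (real n) + euler_mascheroni / ln 2 - 5 / 2 + centred_fluctuation (log 2 (real n)))\<bar>
     \<le> 8 * (1 / real n)" if n: "0 < n" for n
  proof -
    define w where "w = log 2 (real n) - 3"
    have powr: "2 powr w = real n / 8" using n by (simp add: w_def powr_diff)
    have "fluctuation (log 2 (real n)) = fluctuation w"
      using periodic_int[of fluctuation w 3, OF fluctuation_periodic] by (simp add: w_def)
    then have "log 2 (real n) + euler_mascheroni / ln 2 - 5 / 2 + centred_fluctuation (log 2 (real n)) = w + fluctuation w"
      by (simp add: centred_fluctuation_def w_def)
    with doubling_sum_fluctuation[of w] show ?thesis unfolding powr by (simp add: algebra_simps)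
  qed
  show "eventually (\<lambda>n. norm (doubling_sum (real n / 8)
      - (log 2 (real n) + euler_mascheroni / ln 2 - 5 / 2 + centred_fluctuation (log 2 (real n))))
     \<le> 8 * norm (1 / real n)) at_top"
    using eventually_gt_at_top[of "0::nat"]
  proof eventually_elim
    case (elim n)
    then show ?case using le[of n] by simp
  qed
qed

theorem theorem2:
  shows "\<exists>P :: real \<Rightarrow> real.
    continuous_on UNIV P \<and>
    (\<forall>w. P (w + 1) = P w) \<and>
    (\<forall>w. ((\<lambda>k::int. - (1 / complex_of_real (ln 2)) *
              (Gamma (2 * \<i> * of_int k * complex_of_real pi / complex_of_real (ln 2)) *
               exp (- (2 * \<i> * of_int k * complex_of_real pi * complex_of_real w))))
            has_sum complex_of_real (P w)) (UNIV - {0})) \<and>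
    (\<lambda>n::nat. composition_expectation n (\<lambda>xs. real (longest_run xs))
        - (log 2 (real n) + euler_mascheroni / ln 2 - 5 / 2 + P (log 2 (real n))))
      \<in> O(\<lambda>n. (ln (real n))\<^sup>2 / sqrt (real n))"
proof (intro exI[of _ centred_fluctuation] conjI allI centred_fluctuation_fourier)
  show "continuous_on UNIV centred_fluctuation"
    unfolding centred_fluctuation_def by (intro continuous_intros continuous_on_fluctuation)
  show "centred_fluctuation (w + 1) = centred_fluctuation w" for w
    by (simp add: centred_fluctuation_def fluctuation_periodic)
  have "(\<lambda>n. 1 / real n) \<in> O(\<lambda>n. (ln (real n))\<^sup>2 / sqrt (real n))" by real_asymp
  with doubling_sum_asymptotic
  have "(\<lambda>n. doubling_sum (real n / 8)
      - (log 2 (real n) + euler_mascheroni / ln 2 - 5 / 2 + centred_fluctuation (log 2 (real n))))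
     \<in> O(\<lambda>n. (ln (real n))\<^sup>2 / sqrt (real n))"
    by (rule landau_o.big_trans)
  from sum_in_bigo(1)[OF expectation_longest_run_doubling_sum this]
  show "(\<lambda>n::nat. composition_expectation n (\<lambda>xs. real (longest_run xs))
        - (log 2 (real n) + euler_mascheroni / ln 2 - 5 / 2 + centred_fluctuation (log 2 (real n))))
      \<in> O(\<lambda>n. (ln (real n))\<^sup>2 / sqrt (real n))"
    by (simp add: algebra_simps)
qed

end
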